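(* Let $M$ be a regular matroid and $\lambda\in\mathbb{N}^{E(M)}$. Then $\Psi_M(\lambda)=\#\mathrm{Jac}(M_\lambda)$, where $\Psi_M(\lambda)$ denotes $\Psi_M$ evaluated at $\lambda_e=\lambda(e)$ for all $e$.
   Context: $\mathbb{N}$ denotes the positive integers. Configuration polynomial: $\Psi_M=\sum_{B}\prod_{e\in E(M)-B}\lambda_e\in\mathbb{Z}[\lambda_e:e\in E(M)]$, summed over all bases $B$ of $M$ (empty product $=1$). Metric matroid: choose pairwise disjoint sets $E_e$ ($e\in E(M)$) with $\#E_e=\lambda(e)$, $e\in E_e$; $E(M_\lambda)=\bigsqcup_e E_e$; bases of $M_\lambda$ are the sets $E(M_\lambda)-\{x_e:e\notin B'\}$ with $B'$ a basis of $M$ and $x_e\in E_e$ for $e\notin B'$ ($M_\lambda$ is regular when $M$ is). Jacobian group of a regular matroid $N$ on $n$ elements: for an $r\times n$ totally unimodular integer matrix $A$ of rank $r$ representing $N$ over $\mathbb{Q}$, with $\Lambda=\ker A\cap\mathbb{Z}^n$ and $\Lambda^\#=\{x\in\ker A:\langle x,y\rangle\in\mathbb{Z}\ \forall y\in\Lambda\}$, $\mathrm{Jac}(N)=\Lambda^\#/\Lambda$. *)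

theory Defs
  imports Complex_Main "Jordan_Normal_Form.Determinant"
begin

text \<open>Matrices with rows indexed by 0..<r and columns by a finite ground set G.
  A matrix is a function A :: nat => 'e => int.\<close>

definition totally_unimodular :: "(nat \<Rightarrow> 'e \<Rightarrow> int) \<Rightarrow> nat \<Rightarrow> 'e set \<Rightarrow> bool" where
  "totally_unimodular A r G \<longleftrightarrow>
     (\<forall>k (\<rho>::nat \<Rightarrow> nat) (\<gamma>::nat \<Rightarrow> 'e).
        \<rho> ` {..<k} \<subseteq> {..<r} \<and> inj_on \<rho> {..<k} \<and> \<gamma> ` {..<k} \<subseteq> G \<and> inj_on \<gamma> {..<k} \<longrightarrow>
        det (mat k k (\<lambda>(i,j). A (\<rho> i) (\<gamma> j))) \<in> {-1, 0, 1})"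

definition full_row_rank :: "(nat \<Rightarrow> 'e \<Rightarrow> int) \<Rightarrow> nat \<Rightarrow> 'e set \<Rightarrow> bool" where
  "full_row_rank A r G \<longleftrightarrow>
     (\<forall>d :: nat \<Rightarrow> rat. (\<forall>e\<in>G. (\<Sum>i<r. d i * of_int (A i e)) = 0) \<longrightarrow> (\<forall>i<r. d i = 0))"

definition cols_indep :: "(nat \<Rightarrow> 'e \<Rightarrow> int) \<Rightarrow> nat \<Rightarrow> 'e set \<Rightarrow> bool" where
  "cols_indep A r B \<longleftrightarrow>
     (\<forall>c :: 'e \<Rightarrow> rat. (\<forall>i<r. (\<Sum>e\<in>B. c e * of_int (A i e)) = 0) \<longrightarrow> (\<forall>e\<in>B. c e = 0))"

text \<open>A (r x G, rank r) represents over Q the matroid on G with basis family Bs: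
  bases are exactly the sets of columns forming a basis of the column space Q^r.\<close>
definition represents :: "(nat \<Rightarrow> 'e \<Rightarrow> int) \<Rightarrow> nat \<Rightarrow> 'e set \<Rightarrow> 'e set set \<Rightarrow> bool" where
  "represents A r G Bs \<longleftrightarrow>
     Bs = {B. B \<subseteq> G \<and> card B = r \<and> cols_indep A r B}"

definition regular_matroid :: "'e set \<Rightarrow> 'e set set \<Rightarrow> bool" where
  "regular_matroid G Bs \<longleftrightarrow> finite G \<and>
     (\<exists>r A. totally_unimodular A r G \<and> full_row_rank A r G \<and> represents A r G Bs)"

definition config_poly_eval :: "'e set \<Rightarrow> 'e set set \<Rightarrow> ('e \<Rightarrow> nat) \<Rightarrow> nat" where
  "config_poly_eval E Bs lam = (\<Sum>B\<in>Bs. \<Prod>e\<in>E - B. lam e)"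

definition metric_ground :: "'e set \<Rightarrow> ('e \<Rightarrow> 'e set) \<Rightarrow> 'e set" where
  "metric_ground E Ef = (\<Union>e\<in>E. Ef e)"

definition metric_bases :: "'e set \<Rightarrow> 'e set set \<Rightarrow> ('e \<Rightarrow> 'e set) \<Rightarrow> 'e set set" where
  "metric_bases E Bs Ef =
     {metric_ground E Ef - x ` (E - B') | B' x. B' \<in> Bs \<and> (\<forall>e\<in>E - B'. x e \<in> Ef e)}"

text \<open>Lattices: vectors in Q^G are functions 'e => rat vanishing outside G.\<close>
definition kerA :: "(nat \<Rightarrow> 'e \<Rightarrow> int) \<Rightarrow> nat \<Rightarrow> 'e set \<Rightarrow> ('e \<Rightarrow> rat) set" where
  "kerA A r G = {x. (\<forall>e. e \<notin> G \<longrightarrow> x e = 0) \<and>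
                     (\<forall>i<r. (\<Sum>e\<in>G. of_int (A i e) * x e) = 0)}"

definition Lam :: "(nat \<Rightarrow> 'e \<Rightarrow> int) \<Rightarrow> nat \<Rightarrow> 'e set \<Rightarrow> ('e \<Rightarrow> rat) set" where
  "Lam A r G = {x \<in> kerA A r G. \<forall>e. x e \<in> \<int>}"

definition Lam_dual :: "(nat \<Rightarrow> 'e \<Rightarrow> int) \<Rightarrow> nat \<Rightarrow> 'e set \<Rightarrow> ('e \<Rightarrow> rat) set" where
  "Lam_dual A r G = {x \<in> kerA A r G. \<forall>y\<in>Lam A r G. (\<Sum>e\<in>G. x e * y e) \<in> \<int>}"

definition jac :: "(nat \<Rightarrow> 'e \<Rightarrow> int) \<Rightarrow> nat \<Rightarrow> 'e set \<Rightarrow> ('e \<Rightarrow> rat) set set" where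
  "jac A r G = {(\<lambda>y. (\<lambda>e. x e + y e)) ` Lam A r G | x. x \<in> Lam_dual A r G}"

end

theory Submission
  imports Defs
begin

text \<open>Let \<open>A\<close> be a totally unimodular matrix of full row rank representing the metric matroid.
  Since some maximal minor is \<open>\<plusminus>1\<close>, every class of the dual lattice modulo \<open>\<Lambda>\<close> contains
  \<open>w - A\<^sup>T d\<close> with \<open>w\<close> integral and \<open>A A\<^sup>T d = A w\<close>; sending it to \<open>A w\<close> identifies the Jacobian
  group with \<open>\<int>\<^sup>r / A A\<^sup>T \<int>\<^sup>r\<close>, which has \<open>det (A A\<^sup>T)\<close> elements. By Cauchy-Binet this determinant is a
  sum of squares of maximal minors, each 0 or 1, so it counts the bases. A basis of the metric matroid
  is a basis \<open>B\<close> of the original matroid together with one omitted element of each class outside \<open>B\<close>.\<close>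

section \<open>The index of a full-rank integer lattice\<close>

text \<open>The vectors \<open>w - A\<^sup>T d\<close> arise because the dual lattice is the
  orthogonal projection of the integer vectors onto \<open>ker A\<close>: solving the Gram system
  for \<open>d\<close> projects \<open>w\<close>. The unimodular maximal minor comes from the count
  of bases itself. Full row rank makes \<open>A A\<^sup>T\<close> positive definite over the
  rationals, so its determinant, the number of bases, is nonzero; a basis exists, and its minor is a
  nonzero element of {-1, 0, 1}. The claim concerns every totally unimodular \<open>A\<close>
  representing the metric matroid, so the order of the group is computed for an arbitrary such
  \<open>A\<close>. The answer, the number of bases, depends on the matroid alone, which settles
  independence of \<open>A\<close> at once. The explicit extended matrix serves the regularity
  claim, and the weights enter through the count of bases. Indices are measured by finite sets of
  representatives; the same set that measures the index of \<open>A A\<^sup>T \<int>\<^sup>r\<close>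
  later labels the cosets in \<open>jac\<close>.\<close>

definition col_lattice :: "int mat \<Rightarrow> int vec set" where
  "col_lattice M = {M *\<^sub>v v | v. v \<in> carrier_vec (dim_col M)}"

text \<open>Stands in for the quotient group: when \<open>L\<close> is a lattice,
  \<open>card T\<close> is its index, and an induction on the dimension can build \<open>T\<close>
  explicitly.\<close>

definition transversal :: "nat \<Rightarrow> int vec set \<Rightarrow> int vec set \<Rightarrow> bool" where
  "transversal n L T \<longleftrightarrow> finite T \<and> T \<subseteq> carrier_vec n \<and>
     (\<forall>z\<in>carrier_vec n. \<exists>!t. t \<in> T \<and> z - t \<in> L)"

lemma col_lattice_mult_subset:
  assumes "M \<in> carrier_mat n n" "U \<in> carrier_mat n n"
  shows "col_lattice (M * U) \<subseteq> col_lattice M"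
proof
  fix z assume "z \<in> col_lattice (M * U)"
  then obtain v where v: "v \<in> carrier_vec n" "z = M * U *\<^sub>v v"
    using assms by (auto simp: col_lattice_def)
  then have "z = M *\<^sub>v (U *\<^sub>v v)" "U *\<^sub>v v \<in> carrier_vec n"
    using assms by (auto simp: assoc_mult_mat_vec[of M n n U n])
  then show "z \<in> col_lattice M" using assms by (auto simp: col_lattice_def)
qed

text \<open>A column operation is a right multiplication by an integer matrix and can only shrink
  the lattice. Its inverse is an operation of the same kind, which gives the other
  inclusion.\<close>

lemma col_lattice_addcol:
  assumes M: "M \<in> carrier_mat n n" and "k < n" "j \<noteq> k"
  shows "col_lattice (addcol a j k M) = col_lattice M"
proof -
  have sub: "col_lattice (addcol b j k N) \<subseteq> col_lattice N" if N: "N \<in> carrier_mat n n" for b N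
    by (subst addcol_mat[OF N \<open>k < n\<close>], rule col_lattice_mult_subset[OF N]) simp
  have "addcol (- a) j k (addcol a j k M) = M"
    by (rule eq_matI) (use assms in auto)
  moreover have "addcol a j k M \<in> carrier_mat n n" using M by auto
  ultimately show ?thesis using sub[OF M, of a] sub[of "addcol a j k M" "- a"] by simp
qed

lemma col_lattice_swapcols:
  assumes M: "M \<in> carrier_mat n n" and "j < n" "k < n"
  shows "col_lattice (swapcols j k M) = col_lattice M"
proof -
  have sub: "col_lattice (swapcols j k N) \<subseteq> col_lattice N" if N: "N \<in> carrier_mat n n" for N
    by (subst swapcols_mat[OF N assms(2,3)], rule col_lattice_mult_subset[OF N]) simp
  have "swapcols j k (swapcols j k M) = M"
    by (rule eq_matI) (use assms in auto)
  then show ?thesis using sub[OF M] sub[of "swapcols j k M"] M by simp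
qed

text \<open>Euclid's algorithm on the first row, with the sum of the absolute values of its entries
  as measure. Column operations are used because they preserve the lattice itself; the determinant
  is kept up to the sign of a final swap.\<close>

lemma clear_first_row:
  assumes "M \<in> carrier_mat (Suc n) (Suc n)"
  shows "\<exists>N \<in> carrier_mat (Suc n) (Suc n). col_lattice N = col_lattice M \<and>
    \<bar>det N\<bar> = \<bar>det M\<bar> \<and> (\<forall>j. 0 < j \<and> j < Suc n \<longrightarrow> N $$ (0,j) = 0)"
  using assms
proof (induction "nat (\<Sum>j<Suc n. \<bar>M $$ (0,j)\<bar>)" arbitrary: M rule: less_induct)
  case less
  note M = less.prems
  show ?case
  proof (cases "\<exists>j k. j < Suc n \<and> k < Suc n \<and> j \<noteq> k \<and> M $$ (0,j) \<noteq> 0 \<and> M $$ (0,k) \<noteq> 0")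
    case True
    then obtain j' k' where "j' < Suc n" "k' < Suc n" "j' \<noteq> k'" "M $$ (0,j') \<noteq> 0" "M $$ (0,k') \<noteq> 0"
      by blast
    then obtain j k where jk: "j < Suc n" "k < Suc n" "j \<noteq> k" "M $$ (0,k) \<noteq> 0"
      "\<bar>M $$ (0,k)\<bar> \<le> \<bar>M $$ (0,j)\<bar>"
      by (metis linear)
    \<comment> \<open>Entry \<open>j\<close> is replaced by its remainder modulo entry
      \<open>k\<close>. The remainder is smaller in absolute value than the divisor, which was
      chosen no larger than entry \<open>j\<close>; hence the strict drop of the measure.\<close>
    define N where "N = addcol (- (M $$ (0,j) div M $$ (0,k))) j k M"
    have N: "N \<in> carrier_mat (Suc n) (Suc n)" using M by (auto simp: N_def)
    have Nj: "N $$ (0,j) = M $$ (0,j) mod M $$ (0,k)"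
      using M jk by (simp add: N_def minus_div_mult_eq_mod[symmetric])
    have "(\<Sum>i<Suc n. \<bar>N $$ (0,i)\<bar>) < (\<Sum>i<Suc n. \<bar>M $$ (0,i)\<bar>)"
    proof (rule sum_strict_mono_ex1)
      have *: "\<bar>N $$ (0,j)\<bar> < \<bar>M $$ (0,j)\<bar>" using jk Nj abs_mod_less[of "M $$ (0,k)" "M $$ (0,j)"] by simp
      then show "\<exists>i\<in>{..<Suc n}. \<bar>N $$ (0,i)\<bar> < \<bar>M $$ (0,i)\<bar>" using jk by blast
      show "\<forall>i\<in>{..<Suc n}. \<bar>N $$ (0,i)\<bar> \<le> \<bar>M $$ (0,i)\<bar>"
      proof
        fix i assume "i \<in> {..<Suc n}"
        then show "\<bar>N $$ (0,i)\<bar> \<le> \<bar>M $$ (0,i)\<bar>" using * M jk by (cases "i = j") (auto simp: N_def)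
      qed
    qed simp
    moreover have "(\<Sum>i<Suc n. \<bar>N $$ (0,i)\<bar>) \<ge> 0" by (intro sum_nonneg) simp
    ultimately have "nat (\<Sum>i<Suc n. \<bar>N $$ (0,i)\<bar>) < nat (\<Sum>i<Suc n. \<bar>M $$ (0,i)\<bar>)" by linarith
    from less.hyps[OF this N] obtain P where "P \<in> carrier_mat (Suc n) (Suc n)"
      "col_lattice P = col_lattice N" "\<bar>det P\<bar> = \<bar>det N\<bar>" "\<forall>j. 0 < j \<and> j < Suc n \<longrightarrow> P $$ (0,j) = 0" by blast
    moreover have "col_lattice N = col_lattice M" "det N = det M"
      unfolding N_def by (rule col_lattice_addcol[OF M jk(2,3)], rule det_addcol[OF jk(2,3) M])
    ultimately show ?thesis by auto
  next
    case False
    \<comment> \<open>At most one entry of the first row is nonzero by now; if it sits outside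
      column 0, one swap moves it there.\<close>
    show ?thesis
    proof (cases "\<exists>k. 0 < k \<and> k < Suc n \<and> M $$ (0,k) \<noteq> 0")
      case True
      then obtain k where k: "0 < k" "k < Suc n" "M $$ (0,k) \<noteq> 0" by blast
      have "swapcols 0 k M $$ (0,j) = 0" if "0 < j" "j < Suc n" for j
        using False k that M by (cases "j = k") auto
      then show ?thesis
        using M k col_lattice_swapcols[OF M, of 0 k] det_swapcols[of 0 "Suc n" k M]
        by (intro bexI[of _ "swapcols 0 k M"]) auto
    next
      case False
      then show ?thesis using M by blast
    qed
  qed
qed

text \<open>Once the first row is \<open>(a, 0, \<dots>, 0)\<close>, the first coordinate only matters modulo \<open>a\<close>, and fixing it
  leaves a lattice of one dimension less.\<close>

lemma transversal_exists:
  assumes "M \<in> carrier_mat n n" "det M \<noteq> 0"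
  shows "\<exists>T. transversal n (col_lattice M) T \<and> int (card T) = \<bar>det M\<bar>"
  using assms
proof (induction n arbitrary: M)
  case 0
  have "transversal 0 (col_lattice M) {0\<^sub>v 0}"
    using 0 by (auto simp: transversal_def col_lattice_def intro!: eq_vecI exI[of _ "0\<^sub>v 0"])
  then show ?case using 0 by (intro exI[of _ "{0\<^sub>v 0}"]) simp
next
  case (Suc n)
  obtain N where N: "N \<in> carrier_mat (Suc n) (Suc n)" "col_lattice N = col_lattice M"
    "\<bar>det N\<bar> = \<bar>det M\<bar>" and N0: "\<And>j. 0 < j \<Longrightarrow> j < Suc n \<Longrightarrow> N $$ (0,j) = 0"
    using clear_first_row[OF Suc.prems(1)] by blast
  define a where "a = N $$ (0,0)"
  define b where "b = vec n (\<lambda>i. N $$ (Suc i, 0))"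
  define P where "P = mat n n (\<lambda>(i,j). N $$ (Suc i, Suc j))"
  have P: "P \<in> carrier_mat n n" and b: "b \<in> carrier_vec n" by (auto simp: P_def b_def)
  have "N = four_block_mat (mat 1 1 (\<lambda>_. a)) (0\<^sub>m 1 n) (mat n 1 (\<lambda>(i,_). b $ i)) P"
    by (rule eq_matI) (use N N0 in \<open>auto simp: P_def b_def a_def four_block_mat_def Let_def\<close>)
  then have "det N = det (mat 1 1 (\<lambda>_. a)) * det P"
    using P by (simp add: det_four_block_mat_upper_right_zero[where n = 1 and m = n])
  then have detN: "det N = a * det P" by (subst (asm) det_single) auto
  then have nz: "a \<noteq> 0" "det P \<noteq> 0" using N(3) Suc.prems(2) by auto
  from Suc.IH[OF P nz(2)] obtain T where T: "transversal n (col_lattice P) T" "int (card T) = \<bar>det P\<bar>"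
    by blast
  have Nv: "N *\<^sub>v vCons t w = vCons (a * t) (t \<cdot>\<^sub>v b + P *\<^sub>v w)" if w: "w \<in> carrier_vec n" for t w
  proof (rule eq_vecI)
    fix i assume "i < dim_vec (vCons (a * t) (t \<cdot>\<^sub>v b + P *\<^sub>v w))"
    then have i: "i < Suc n" using P by simp
    have "row N i = vCons (if i = 0 then a else b $ (i - 1)) (if i = 0 then 0\<^sub>v n else row P (i - 1))"
      by (rule eq_vecI) (use N N0 i in \<open>auto simp: vec_index_vCons P_def b_def a_def\<close>)
    then show "(N *\<^sub>v vCons t w) $ i = vCons (a * t) (t \<cdot>\<^sub>v b + P *\<^sub>v w) $ i"
      using N i P b w by (auto simp: vec_index_vCons)
  qed (use N P in auto)
  \<comment> \<open>The first coordinate determines the multiple \<open>t\<close> of the first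
    column of \<open>N\<close>; the rest of the vector must then come from the remaining columns,
    that is, from \<open>P\<close>.\<close>
  have mem: "vCons s u \<in> col_lattice N \<longleftrightarrow> (\<exists>t. s = a * t \<and> u - t \<cdot>\<^sub>v b \<in> col_lattice P)"
    if u: "u \<in> carrier_vec n" for s u
  proof
    assume "vCons s u \<in> col_lattice N"
    then obtain v where v: "v \<in> carrier_vec (Suc n)" "vCons s u = N *\<^sub>v v"
      using N by (auto simp: col_lattice_def)
    then obtain t w where tw: "v = vCons t w" "w \<in> carrier_vec n"
      by (cases v rule: vec_cases) auto
    then have "s = a * t" "u = t \<cdot>\<^sub>v b + P *\<^sub>v w" using v Nv by auto
    moreover from this have "u - t \<cdot>\<^sub>v b = P *\<^sub>v w"
      using P b tw by (intro eq_vecI) auto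
    ultimately show "\<exists>t. s = a * t \<and> u - t \<cdot>\<^sub>v b \<in> col_lattice P"
      using P tw by (auto simp: col_lattice_def)
  next
    assume "\<exists>t. s = a * t \<and> u - t \<cdot>\<^sub>v b \<in> col_lattice P"
    then obtain t w where tw: "s = a * t" "w \<in> carrier_vec n" "u - t \<cdot>\<^sub>v b = P *\<^sub>v w"
      using P by (auto simp: col_lattice_def)
    have "u = t \<cdot>\<^sub>v b + P *\<^sub>v w"
      unfolding tw(3)[symmetric] using b u by (intro eq_vecI) auto
    then have "vCons s u = N *\<^sub>v vCons t w" using Nv tw by simp
    then show "vCons s u \<in> col_lattice N"
      using N(1) tw unfolding col_lattice_def by (intro CollectI exI[of _ "vCons t w"]) simp
  qed
  define S where "S = (\<lambda>(i,y). vCons i y) ` ({0..<\<bar>a\<bar>} \<times> T)"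
  have Tc: "finite T" "T \<subseteq> carrier_vec n" using T by (auto simp: transversal_def)
  have "card S = card ({0..<\<bar>a\<bar>} \<times> T)"
    unfolding S_def by (rule card_image) (auto simp: inj_on_def)
  then have "int (card S) = \<bar>det M\<bar>"
    using T(2) N(3) detN by (simp add: card_cartesian_product abs_mult)
  moreover have "transversal (Suc n) (col_lattice N) S"
    unfolding transversal_def
  proof (intro conjI ballI)
    show "finite S" "S \<subseteq> carrier_vec (Suc n)" using Tc by (auto simp: S_def)
    fix z :: "int vec" assume "z \<in> carrier_vec (Suc n)"
    then obtain s u where z: "z = vCons s u" and u: "u \<in> carrier_vec n"
      by (cases z rule: vec_cases) auto
    have diff: "vCons s u - vCons i y = vCons (s - i) (u - y)" if "y \<in> carrier_vec n" for i y
      by (rule eq_vecI) (use u that in \<open>auto simp: vec_index_vCons\<close>)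
    have uni: "\<exists>!y. y \<in> T \<and> (u - t \<cdot>\<^sub>v b) - y \<in> col_lattice P" for t
      using T u b by (auto simp: transversal_def)
    have comm: "(u - y) - t \<cdot>\<^sub>v b = (u - t \<cdot>\<^sub>v b) - y" if "y \<in> T" for y t
      by (rule eq_vecI) (use u b that Tc in auto)
    \<comment> \<open>The first coordinate of a representative is forced to be the residue of
      \<open>s\<close>. This fixes \<open>t\<close>, and \<open>T\<close> supplies exactly one
      \<open>y\<close> for the shifted vector \<open>u - t b\<close>; the choice of \<open>y\<close>
      thus depends on the quotient of \<open>s - i\<close> by \<open>a\<close>.\<close>
    have key: "i \<in> {0..<\<bar>a\<bar>} \<and> y \<in> T \<and> z - vCons i y \<in> col_lattice N \<longleftrightarrow>
       i = s mod \<bar>a\<bar> \<and> y \<in> T \<and> (u - ((s - i) div a) \<cdot>\<^sub>v b) - y \<in> col_lattice P" for i y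
    proof (cases "y \<in> T")
      case True
      then have y: "y \<in> carrier_vec n" using Tc by auto
      have "z - vCons i y \<in> col_lattice N \<longleftrightarrow>
        (\<exists>t. s - i = a * t \<and> (u - t \<cdot>\<^sub>v b) - y \<in> col_lattice P)"
        using mem[of "u - y" "s - i"] u y by (simp add: z diff comm[OF True])
      also have "\<dots> \<longleftrightarrow> a dvd s - i \<and> (u - ((s - i) div a) \<cdot>\<^sub>v b) - y \<in> col_lattice P"
        using nz by (auto simp: dvd_def)
      also have "a dvd s - i \<longleftrightarrow> s mod \<bar>a\<bar> = i mod \<bar>a\<bar>"
        by (metis abs_dvd_iff mod_eq_dvd_iff)
      finally show ?thesis using True nz by auto
    qed auto
    let ?i = "s mod \<bar>a\<bar>"
    from uni obtain y where y: "y \<in> T" "(u - ((s - ?i) div a) \<cdot>\<^sub>v b) - y \<in> col_lattice P" by blast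
    show "\<exists>!t. t \<in> S \<and> z - t \<in> col_lattice N"
    proof (rule ex1I[of _ "vCons ?i y"])
      show "vCons ?i y \<in> S \<and> z - vCons ?i y \<in> col_lattice N"
        using key[of ?i y] y by (auto simp: S_def)
      fix t assume t: "t \<in> S \<and> z - t \<in> col_lattice N"
      then obtain i x where "t = vCons i x" "i \<in> {0..<\<bar>a\<bar>}" "x \<in> T" by (auto simp: S_def)
      with t key[of i x] y uni[of "(s - ?i) div a"] show "t = vCons ?i y" by auto
    qed
  qed
  ultimately show ?case unfolding N(2) by blast
qed

section \<open>The Cauchy-Binet formula\<close>

text \<open>Expanding the product of row sums gives a sum over all maps \<open>f\<close> from row
  indices to \<open>G\<close>. A non-injective \<open>f\<close> produces two equal rows; an
  injective one is its image \<open>B\<close> together with a permutation relative to the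
  enumeration \<open>\<beta> B\<close>, and summing over the permutations rebuilds the first minor.
  The enumeration fixes a column order; another order would change both minors by the same
  sign.\<close>

lemma cauchy_binet:
  fixes A A' :: "nat \<Rightarrow> 'e \<Rightarrow> 'a :: comm_ring_1"
  assumes G: "finite G" and \<beta>: "\<And>B. B \<subseteq> G \<Longrightarrow> card B = r \<Longrightarrow> bij_betw (\<beta> B) {..<r} B"
  shows "det (mat r r (\<lambda>(i,j). \<Sum>e\<in>G. A i e * A' j e)) =
    (\<Sum>B | B \<subseteq> G \<and> card B = r. det (mat r r (\<lambda>(i,j). A i (\<beta> B j))) * det (mat r r (\<lambda>(i,j). A' i (\<beta> B j))))"
proof -
  let ?I = "{0..<r}" and ?S = "{p. p permutes {0..<r}}"
  let ?F = "?I \<rightarrow>\<^sub>E G"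
  let ?Bs = "{B. B \<subseteq> G \<and> card B = r}"
  \<comment> \<open>This minor is written transposed, so that equal values of \<open>f\<close>
    become equal rows and a permutation of the arguments of \<open>f\<close> becomes a permutation
    of rows.\<close>
  define D where "D f = det (mat r r (\<lambda>(i,j). A' j (f i)))" for f :: "nat \<Rightarrow> 'e"
  have Dcong: "D f = D g" if "\<And>i. i < r \<Longrightarrow> f i = g i" for f g
    unfolding D_def by (rule arg_cong[of _ _ det], rule eq_matI) (use that in auto)
  have "det (mat r r (\<lambda>(i,j). \<Sum>e\<in>G. A i e * A' j e)) =
      (\<Sum>p\<in>?S. signof p * (\<Prod>i\<in>?I. \<Sum>e\<in>G. A i e * A' (p i) e))"
    by (subst det_def'[of _ r]) (auto intro!: sum.cong prod.cong simp: permutes_in_image)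
  also have "\<dots> = (\<Sum>p\<in>?S. \<Sum>f\<in>?F. signof p * (\<Prod>i\<in>?I. A i (f i) * A' (p i) (f i)))"
    using G by (simp add: prod_sum_PiE sum_distrib_left)
  also have "\<dots> = (\<Sum>f\<in>?F. \<Sum>p\<in>?S. signof p * (\<Prod>i\<in>?I. A i (f i) * A' (p i) (f i)))"
    by (rule sum.swap)
  also have "\<dots> = (\<Sum>f\<in>?F. (\<Prod>i\<in>?I. A i (f i)) * D f)"
    unfolding D_def
    by (subst det_def'[of _ r])
      (auto intro!: sum.cong prod.cong simp: permutes_in_image sum_distrib_left prod.distrib mult_ac)
  also have "\<dots> = (\<Sum>f | f \<in> ?F \<and> inj_on f ?I. (\<Prod>i\<in>?I. A i (f i)) * D f)"
  proof (rule sum.mono_neutral_right)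
    show "finite ?F" using G by (simp add: finite_PiE)
    show "\<forall>f\<in>?F - {f. f \<in> ?F \<and> inj_on f ?I}. (\<Prod>i\<in>?I. A i (f i)) * D f = 0"
    proof
      fix f assume "f \<in> ?F - {f. f \<in> ?F \<and> inj_on f ?I}"
      then obtain i j where "i < r" "j < r" "i \<noteq> j" "f i = f j" by (auto simp: inj_on_def)
      then have "D f = 0" unfolding D_def
        by (intro det_identical_rows[of _ r i j]) auto
      then show "(\<Prod>i\<in>?I. A i (f i)) * D f = 0" by simp
    qed
  qed auto
  \<comment> \<open>The two conventions outside the index range differ: permutations are the
    identity there, extensional functions are undefined. Hence \<open>else i\<close> in one
    direction and \<open>restrict\<close> in the other.\<close>
  also have "\<dots> = (\<Sum>(B,p)\<in>?Bs \<times> ?S. (\<Prod>i\<in>?I. A i (\<beta> B (p i))) * D (\<beta> B \<circ> p))"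
  proof (rule sum.reindex_bij_witness[symmetric,
      where i = "\<lambda>f. (f ` ?I, \<lambda>i. if i < r then inv_into {..<r} (\<beta> (f ` ?I)) (f i) else i)"
      and j = "\<lambda>(B,p). restrict (\<beta> B \<circ> p) ?I"])
    fix f assume "f \<in> {f \<in> ?F. inj_on f ?I}"
    then have f: "f \<in> ?F" "inj_on f ?I" by auto
    define B where "B = f ` ?I"
    define p where "p i = (if i < r then inv_into {..<r} (\<beta> B) (f i) else i)" for i
    have B: "B \<subseteq> G" "card B = r" using f by (auto simp: B_def card_image)
    note b = \<beta>[OF B]
    have fb: "bij_betw f ?I B" using f by (auto simp: B_def bij_betw_def)
    have inv: "\<beta> B (inv_into {..<r} (\<beta> B) (f i)) = f i" if "i < r" for i
      using b that by (intro f_inv_into_f) (auto simp: bij_betw_def B_def)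
    have "bij_betw (inv_into {..<r} (\<beta> B) \<circ> f) ?I ?I"
      using bij_betw_trans[OF fb bij_betw_inv_into[OF b]] by (simp add: atLeast0LessThan)
    then have "bij_betw p ?I ?I"
      by (rule bij_betw_cong[THEN iffD1, rotated]) (auto simp: p_def)
    then have p: "p permutes ?I"
      by (rule bij_imp_permutes) (auto simp: p_def)
    show "(case (f ` ?I, \<lambda>i. if i < r then inv_into {..<r} (\<beta> (f ` ?I)) (f i) else i) of
        (B, p) \<Rightarrow> restrict (\<beta> B \<circ> p) ?I) = f"
      using f inv by (auto simp: B_def fun_eq_iff PiE_iff extensional_def)
    show "(f ` ?I, \<lambda>i. if i < r then inv_into {..<r} (\<beta> (f ` ?I)) (f i) else i) \<in> ?Bs \<times> ?S"
      using B p unfolding B_def p_def[abs_def] by auto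
  next
    fix x assume "x \<in> ?Bs \<times> ?S"
    then obtain B p where x: "x = (B, p)" and B: "B \<subseteq> G" "card B = r" and p: "p permutes ?I" by auto
    note b = \<beta>[OF B]
    have bp: "bij_betw (\<beta> B \<circ> p) ?I B"
      using bij_betw_trans[OF permutes_imp_bij[OF p]] b by (simp add: atLeast0LessThan)
    have im: "restrict (\<beta> B \<circ> p) ?I ` ?I = B" using bp by (simp add: bij_betw_def)
    have pin: "p i < r" if "i < r" for i using permutes_in_image[OF p, of i] that by simp
    have "inv_into {..<r} (\<beta> B) (\<beta> B (p i)) = p i" if "i < r" for i
      using b pin[OF that] by (intro inv_into_f_f) (auto simp: bij_betw_def)
    moreover have "p i = i" if "\<not> i < r" for i using p that by (auto simp: permutes_def)
    ultimately have "(\<lambda>i. if i < r then inv_into {..<r} (\<beta> B) (restrict (\<beta> B \<circ> p) ?I i) else i) = p"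
      by (auto simp: fun_eq_iff)
    then show "(\<lambda>f. (f ` ?I, \<lambda>i. if i < r then inv_into {..<r} (\<beta> (f ` ?I)) (f i) else i))
       (case x of (B, p) \<Rightarrow> restrict (\<beta> B \<circ> p) ?I) = x"
      unfolding x prod.case im by simp
    have "(\<beta> B \<circ> p) i \<in> G" if "i < r" for i
      using bp B that by (auto simp: bij_betw_def)
    then show "(case x of (B, p) \<Rightarrow> restrict (\<beta> B \<circ> p) ?I) \<in> {f \<in> ?F. inj_on f ?I}"
      using bp unfolding x prod.case bij_betw_def mem_Collect_eq inj_on_restrict_eq
      by (intro conjI restrict_PiE_iff[THEN iffD2] ballI) simp_all
    have "D (restrict (\<beta> B \<circ> p) ?I) = D (\<beta> B \<circ> p)" by (rule Dcong) simp
    moreover have "(\<Prod>i\<in>?I. A i (restrict (\<beta> B \<circ> p) ?I i)) = (\<Prod>i\<in>?I. A i (\<beta> B (p i)))"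
      by (rule prod.cong) simp_all
    ultimately show "(\<Prod>i\<in>?I. A i ((case x of (B, p) \<Rightarrow> restrict (\<beta> B \<circ> p) ?I) i)) * D (case x of (B, p) \<Rightarrow> restrict (\<beta> B \<circ> p) ?I)
      = (case x of (B, p) \<Rightarrow> (\<Prod>i\<in>?I. A i (\<beta> B (p i))) * D (\<beta> B \<circ> p))"
      unfolding x by simp
  qed
  also have "\<dots> = (\<Sum>B\<in>?Bs. \<Sum>p\<in>?S. (\<Prod>i\<in>?I. A i (\<beta> B (p i))) * D (\<beta> B \<circ> p))"
    by (simp add: sum.cartesian_product)
  also have "\<dots> = (\<Sum>B\<in>?Bs. det (mat r r (\<lambda>(i,j). A i (\<beta> B j))) * det (mat r r (\<lambda>(i,j). A' i (\<beta> B j))))"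
  proof (rule sum.cong[OF refl])
    fix B
    have Dp: "D (\<beta> B \<circ> p) = signof p * D (\<beta> B)" if p: "p \<in> ?S" for p
    proof -
      have pin: "p i < r" if "i < r" for i using p permutes_in_image[of p ?I i] that by simp
      let ?M = "mat r r (\<lambda>(i,j). A' j (\<beta> B i))"
      have "mat r r (\<lambda>(i,j). A' j ((\<beta> B \<circ> p) i)) = mat r r (\<lambda>(i,j). ?M $$ (p i, j))"
        by (rule eq_matI) (auto simp: pin)
      then show ?thesis unfolding D_def using p by (simp add: det_permute_rows)
    qed
    have "D (\<beta> B) = det (transpose_mat (mat r r (\<lambda>(i,j). A' i (\<beta> B j))))"
      unfolding D_def by (rule arg_cong[of _ _ det], rule eq_matI) auto
    then have DB: "D (\<beta> B) = det (mat r r (\<lambda>(i,j). A' i (\<beta> B j)))"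
      by (subst (asm) det_transpose) auto
    have "(\<Sum>p\<in>?S. (\<Prod>i\<in>?I. A i (\<beta> B (p i))) * D (\<beta> B \<circ> p)) =
      (\<Sum>p\<in>?S. signof p * (\<Prod>i\<in>?I. A i (\<beta> B (p i)))) * D (\<beta> B)"
      unfolding sum_distrib_right by (rule sum.cong[OF refl]) (simp only: Dp mult_ac)
    also have "(\<Sum>p\<in>?S. signof p * (\<Prod>i\<in>?I. A i (\<beta> B (p i)))) = det (mat r r (\<lambda>(i,j). A i (\<beta> B j)))"
      by (subst det_def'[of _ r]) (auto intro!: sum.cong prod.cong simp: permutes_in_image)
    finally show "(\<Sum>p\<in>?S. (\<Prod>i\<in>?I. A i (\<beta> B (p i))) * D (\<beta> B \<circ> p)) =
      det (mat r r (\<lambda>(i,j). A i (\<beta> B j))) * det (mat r r (\<lambda>(i,j). A' i (\<beta> B j)))"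
      unfolding DB .
  qed
  finally show ?thesis .
qed

section \<open>Representing the metric matroid\<close>

lemma det_0_iff_kernel:
  fixes f :: "nat \<Rightarrow> nat \<Rightarrow> 'a :: field"
  shows "det (mat k k (\<lambda>(i,j). f i j)) = 0 \<longleftrightarrow>
    (\<exists>v. (\<exists>j<k. v j \<noteq> 0) \<and> (\<forall>i<k. (\<Sum>j<k. v j * f i j) = 0))"
proof -
  let ?M = "mat k k (\<lambda>(i,j). f i j)"
  have Mv: "(?M *\<^sub>v v) $ i = (\<Sum>j<k. v $ j * f i j)" if "v \<in> carrier_vec k" "i < k" for v i
    using that by (auto simp: scalar_prod_def atLeast0LessThan mult.commute intro!: sum.cong)
  have "det ?M = 0 \<longleftrightarrow> (\<exists>v. v \<in> carrier_vec k \<and> v \<noteq> 0\<^sub>v k \<and> ?M *\<^sub>v v = 0\<^sub>v k)"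
    by (rule det_0_iff_vec_prod_zero_field) simp
  also have "\<dots> \<longleftrightarrow> (\<exists>v. (\<exists>j<k. v j \<noteq> 0) \<and> (\<forall>i<k. (\<Sum>j<k. v j * f i j) = 0))"
  proof
    assume "\<exists>v. v \<in> carrier_vec k \<and> v \<noteq> 0\<^sub>v k \<and> ?M *\<^sub>v v = 0\<^sub>v k"
    then obtain v where v: "v \<in> carrier_vec k" "v \<noteq> 0\<^sub>v k" "?M *\<^sub>v v = 0\<^sub>v k" by blast
    from v(1,2) have "\<exists>j<k. v $ j \<noteq> 0" by (metis carrier_vecD eq_vecI index_zero_vec)
    moreover have "\<forall>i<k. (\<Sum>j<k. v $ j * f i j) = 0" using Mv[OF v(1)] v(3) by (metis index_zero_vec(1))
    ultimately show "\<exists>v. (\<exists>j<k. v j \<noteq> 0) \<and> (\<forall>i<k. (\<Sum>j<k. v j * f i j) = 0)" by blast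
  next
    assume "\<exists>v. (\<exists>j<k. v j \<noteq> 0) \<and> (\<forall>i<k. (\<Sum>j<k. v j * f i j) = 0)"
    then obtain v j where v: "j < k" "v j \<noteq> 0" "\<forall>i<k. (\<Sum>j<k. v j * f i j) = 0" by blast
    have "?M *\<^sub>v vec k v = 0\<^sub>v k"
    proof (rule eq_vecI)
      fix i assume "i < dim_vec (0\<^sub>v k :: 'a vec)"
      then show "(?M *\<^sub>v vec k v) $ i = 0\<^sub>v k $ i" using v Mv[of "vec k v" i] by simp
    qed simp
    moreover have "vec k v \<noteq> 0\<^sub>v k" using v by (metis index_vec index_zero_vec(1))
    ultimately show "\<exists>v. v \<in> carrier_vec k \<and> v \<noteq> 0\<^sub>v k \<and> ?M *\<^sub>v v = 0\<^sub>v k" by (metis vec_carrier)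
  qed
  finally show ?thesis .
qed

lemma cols_indep_reindex:
  assumes b: "bij_betw b {..<k} B"
  shows "cols_indep A r B \<longleftrightarrow>
    (\<forall>v :: nat \<Rightarrow> rat. (\<forall>i<r. (\<Sum>j<k. v j * of_int (A i (b j))) = 0) \<longrightarrow> (\<forall>j<k. v j = 0))"
    (is "_ \<longleftrightarrow> ?R")
proof
  assume ind: "cols_indep A r B"
  show ?R
  proof (intro allI impI)
    fix v :: "nat \<Rightarrow> rat" and j
    assume v: "\<forall>i<r. (\<Sum>j<k. v j * of_int (A i (b j))) = 0" and j: "j < k"
    define c where "c e = v (inv_into {..<k} b e)" for e
    have c: "c (b j) = v j" if "j < k" for j
      using b that by (simp add: c_def bij_betw_inv_into_left)
    have "(\<Sum>e\<in>B. c e * of_int (A i e)) = (\<Sum>j<k. v j * of_int (A i (b j)))" for i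
      by (subst sum.reindex_bij_betw[OF b, symmetric]) (simp add: c)
    with ind v have "\<forall>e\<in>B. c e = 0" by (simp add: cols_indep_def)
    moreover have "b j \<in> B" using b j by (auto simp: bij_betw_def)
    ultimately show "v j = 0" using c[OF j] by simp
  qed
next
  assume R: ?R
  show "cols_indep A r B" unfolding cols_indep_def
  proof (intro allI impI ballI)
    fix c :: "'a \<Rightarrow> rat" and e
    assume "\<forall>i<r. (\<Sum>e\<in>B. c e * of_int (A i e)) = 0" and e: "e \<in> B"
    then have "\<forall>i<r. (\<Sum>j<k. c (b j) * of_int (A i (b j))) = 0"
      by (simp add: sum.reindex_bij_betw[OF b, of "\<lambda>e. c e * of_int (A _ e)"])
    then have "\<forall>j<k. c (b j) = 0" using R[rule_format, of "\<lambda>j. c (b j)"] by blast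
    moreover obtain j where "j < k" "e = b j" using b e by (auto simp: bij_betw_def)
    ultimately show "c e = 0" by blast
  qed
qed

lemma cols_indep_iff_det:
  assumes "bij_betw b {..<r} B"
  shows "cols_indep A r B \<longleftrightarrow> det (mat r r (\<lambda>(i,j). A i (b j))) \<noteq> 0"
proof -
  have "map_mat rat_of_int (mat r r (\<lambda>(i,j). A i (b j))) = mat r r (\<lambda>(i,j). of_int (A i (b j)))"
    by (rule eq_matI) auto
  then have "rat_of_int (det (mat r r (\<lambda>(i,j). A i (b j)))) = det (mat r r (\<lambda>(i,j). of_int (A i (b j))))"
    by (metis of_int_hom.hom_det)
  then show ?thesis
    unfolding cols_indep_reindex[OF assms]
    using det_0_iff_kernel[of r "\<lambda>i j. rat_of_int (A i (b j))"] by auto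
qed

lemma card_le_if_cols_indep:
  assumes "finite B" "cols_indep A r B"
  shows "card B \<le> r"
proof (rule ccontr)
  assume "\<not> card B \<le> r"
  define k where "k = card B"
  have k: "r < k" using \<open>\<not> card B \<le> r\<close> by (simp add: k_def)
  obtain b where b: "bij_betw b {..<k} B"
    using ex_bij_betw_nat_finite[OF assms(1)] by (auto simp: k_def atLeast0LessThan)
  \<comment> \<open>Padding with zero rows makes the matrix square. Row \<open>r\<close> is one of
    them because \<open>r < k\<close>, so the determinant vanishes and a kernel vector is a
    dependency of the columns.\<close>
  let ?f = "\<lambda>i j. if i < r then rat_of_int (A i (b j)) else 0"
  have "det (mat k k (\<lambda>(i,j). ?f i j)) = 0"
    using k by (subst laplace_expansion_row[of _ k r]) auto
  then obtain v j where "j < k" "v j \<noteq> 0" "\<forall>i<k. (\<Sum>j<k. v j * ?f i j) = 0"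
    unfolding det_0_iff_kernel by blast
  moreover have "(\<Sum>j<k. v j * rat_of_int (A i (b j))) = 0" if "i < r" for i
    using calculation(3)[rule_format, of i] that k by simp
  ultimately show False using assms(2) unfolding cols_indep_reindex[OF b] by blast
qed

text \<open>Deleting a row and a column merely precomposes the selection maps with
  \<open>insert_index\<close>, so a cofactor is, up to sign, a minor of the shape covered by the
  induction hypothesis on unimodularity.\<close>

lemma cofactor_minor:
  assumes "i < Suc k" "j < Suc k"
  shows "cofactor (mat (Suc k) (Suc k) (\<lambda>(i,j). N (\<rho> i) (\<gamma> j))) i j =
    (-1) ^ (i + j) * det (mat k k (\<lambda>(i',j'). N ((\<rho> \<circ> insert_index i) i') ((\<gamma> \<circ> insert_index j) j')))"
proof -
  have "mat_delete (mat (Suc k) (Suc k) (\<lambda>(i,j). N (\<rho> i) (\<gamma> j))) i j =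
    mat k k (\<lambda>(i',j'). N ((\<rho> \<circ> insert_index i) i') ((\<gamma> \<circ> insert_index j) j'))"
    by (rule eq_matI) (auto simp: mat_delete_def insert_index_def)
  then show ?thesis by (simp add: cofactor_def)
qed

lemma insert_index_comp:
  assumes "\<rho> ` {..<Suc k} \<subseteq> R" "inj_on \<rho> {..<Suc k}"
  shows "(\<rho> \<circ> insert_index i) ` {..<k} \<subseteq> R" "inj_on (\<rho> \<circ> insert_index i) {..<k}"
proof -
  have "insert_index i ` {..<k} \<subseteq> {..<Suc k}" by (auto simp: insert_index_def)
  then show "(\<rho> \<circ> insert_index i) ` {..<k} \<subseteq> R" using assms(1) by fastforce
  show "inj_on (\<rho> \<circ> insert_index i) {..<k}"
    by (rule comp_inj_on)
      (use assms(2) \<open>insert_index i ` {..<k} \<subseteq> {..<Suc k}\<close> in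
        \<open>auto simp: inj_on_def insert_index_def split: if_splits\<close>)
qed

text \<open>Here \<open>g\<close> enumerates the new elements and \<open>p\<close> maps each of them to its class representative in \<open>E\<close>;
  row \<open>r + q\<close> is the equation \<open>x\<^bsub>g q\<^esub> = x\<^bsub>p (g q)\<^esub>\<close>, so the kernel consists of the vectors of
  \<open>ker A\<close> extended to be constant on each class.\<close>

definition metric_matrix ::
  "(nat \<Rightarrow> 'e \<Rightarrow> int) \<Rightarrow> nat \<Rightarrow> 'e set \<Rightarrow> (nat \<Rightarrow> 'e) \<Rightarrow> ('e \<Rightarrow> 'e) \<Rightarrow> nat \<Rightarrow> 'e \<Rightarrow> int" where
  "metric_matrix A r E g p i x =
    (if i < r then (if x \<in> E then A i x else 0)
     else if x = g (i - r) then 1 else if x = p (g (i - r)) then -1 else 0)"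

text \<open>Induction on the size of the minor. A selected column from \<open>F\<close> has at most
  one nonzero entry, a 1. If all selected columns lie in \<open>E\<close>, a selected row beyond
  \<open>r\<close> has at most one nonzero entry, a -1. In both cases Laplace expansion leaves at
  most one cofactor; otherwise the minor is one of \<open>A\<close>.\<close>

lemma totally_unimodular_metric_matrix:
  assumes A: "totally_unimodular A r E" and g: "bij_betw g {..<m} F"
    and disj: "E \<inter> F = {}" and p: "p ` F \<subseteq> E"
  shows "totally_unimodular (metric_matrix A r E g p) (r + m) (E \<union> F)"
proof -
  let ?N = "metric_matrix A r E g p"
  have "det (mat k k (\<lambda>(i,j). ?N (\<rho> i) (\<gamma> j))) \<in> {-1,0,1}"
    if "\<rho> ` {..<k} \<subseteq> {..<r + m}" "inj_on \<rho> {..<k}" "\<gamma> ` {..<k} \<subseteq> E \<union> F" "inj_on \<gamma> {..<k}"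
    for k \<rho> \<gamma>
    using that
  proof (induction k arbitrary: \<rho> \<gamma>)
    case 0
    show ?case by simp
  next
    case (Suc k)
    note \<rho> = Suc.prems(1,2) and \<gamma> = Suc.prems(3,4)
    let ?M = "mat (Suc k) (Suc k) (\<lambda>(i,j). ?N (\<rho> i) (\<gamma> j))"
    have cof: "cofactor ?M i j \<in> {-1,0,1}" if "i < Suc k" "j < Suc k" for i j
      using Suc.IH[OF insert_index_comp[OF \<rho>, of i] insert_index_comp[OF \<gamma>, of j]]
      by (cases "even (i + j)") (auto simp: cofactor_minor[OF that])
    have gF: "g q \<in> F" if "q < m" for q using g that by (auto simp: bij_betw_def)
    have ginj: "q = q'" if "g q = g q'" "q < m" "q' < m" for q q'
      using g that by (auto simp: bij_betw_def inj_on_def)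
    have gE: "g q \<notin> E" if "q < m" for q using gF[OF that] disj by blast
    have pg: "g q \<noteq> p (g q')" if "q < m" "q' < m" for q q' using gE that gF p by (metis image_subset_iff)
    have \<rho>m: "\<rho> i - r < m" if "i < Suc k" "r \<le> \<rho> i" for i using \<rho>(1) that by fastforce
    consider (col) j where "j < Suc k" "\<gamma> j \<in> F"
      | (row) i where "i < Suc k" "r \<le> \<rho> i" "\<gamma> ` {..<Suc k} \<subseteq> E"
      | (sub) "\<rho> ` {..<Suc k} \<subseteq> {..<r}" "\<gamma> ` {..<Suc k} \<subseteq> E"
    proof (cases "\<gamma> ` {..<Suc k} \<subseteq> E")
      case True
      then show thesis using row sub by (metis image_subsetI lessThan_iff not_less)
    next
      case False
      then show thesis using col \<gamma>(1) by blast
    qed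
    then show ?case
    proof cases
      case col
      then obtain q where q: "q < m" "\<gamma> j = g q" using g by (auto simp: bij_betw_def)
      have ent: "?M $$ (i,j) = (if \<rho> i = r + q then 1 else 0)" if "i < Suc k" for i
        using that col q gE pg pg[symmetric] \<rho>m[OF that] ginj[of q "\<rho> i - r"]
        by (auto simp: metric_matrix_def)
      have "det ?M = (\<Sum>i<Suc k. ?M $$ (i,j) * cofactor ?M i j)"
        using col by (intro laplace_expansion_column) auto
      also have "\<dots> = (\<Sum>i<Suc k. if \<rho> i = r + q then cofactor ?M i j else 0)"
        by (intro sum.cong) (auto simp: ent simp del: index_mat)
      also have "\<dots> \<in> {-1,0,1}"
      proof (cases "\<exists>i0<Suc k. \<rho> i0 = r + q")
        case True
        then obtain i0 where i0: "i0 < Suc k" "\<rho> i0 = r + q" by blast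
        have "(\<Sum>i<Suc k. if \<rho> i = r + q then cofactor ?M i j else 0) =
          (\<Sum>i<Suc k. if i = i0 then cofactor ?M i j else 0)"
          using \<rho>(2) i0 by (intro sum.cong if_cong) (auto simp: inj_on_def)
        also have "\<dots> = cofactor ?M i0 j" using i0 by (subst sum.delta) auto
        finally show ?thesis using cof[OF i0(1) col(1)] by (simp only:)
      next
        case False
        then have "(\<Sum>i<Suc k. if \<rho> i = r + q then cofactor ?M i j else 0) = 0"
          by (intro sum.neutral) auto
        then show ?thesis by (simp only: insert_iff simp_thms)
      qed
      finally show ?thesis .
    next
      case row
      let ?e = "p (g (\<rho> i - r))"
      have ent: "?M $$ (i,j) = (if \<gamma> j = ?e then -1 else 0)" if "j < Suc k" for j
        using that row gE[OF \<rho>m[OF row(1,2)]] by (auto simp: metric_matrix_def)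
      have "det ?M = (\<Sum>j<Suc k. ?M $$ (i,j) * cofactor ?M i j)"
        using row by (intro laplace_expansion_row) auto
      also have "\<dots> = (\<Sum>j<Suc k. if \<gamma> j = ?e then - cofactor ?M i j else 0)"
        by (intro sum.cong) (auto simp: ent simp del: index_mat)
      also have "\<dots> \<in> {-1,0,1}"
      proof (cases "\<exists>j0<Suc k. \<gamma> j0 = ?e")
        case True
        then obtain j0 where j0: "j0 < Suc k" "\<gamma> j0 = ?e" by blast
        have "(\<Sum>j<Suc k. if \<gamma> j = ?e then - cofactor ?M i j else 0) =
          (\<Sum>j<Suc k. if j = j0 then - cofactor ?M i j else 0)"
          using \<gamma>(2) j0 by (intro sum.cong if_cong) (auto simp: inj_on_def)
        also have "\<dots> = - cofactor ?M i j0" using j0 by (subst sum.delta) auto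
        finally have eq: "(\<Sum>j<Suc k. if \<gamma> j = ?e then - cofactor ?M i j else 0) = - cofactor ?M i j0" .
        show ?thesis unfolding eq using cof[OF row(1) j0(1)] by auto
      next
        case False
        then have "(\<Sum>j<Suc k. if \<gamma> j = ?e then - cofactor ?M i j else 0) = 0"
          by (intro sum.neutral) auto
        then show ?thesis by (simp only: insert_iff simp_thms)
      qed
      finally show ?thesis .
    next
      case sub
      have "?M = mat (Suc k) (Suc k) (\<lambda>(i,j). A (\<rho> i) (\<gamma> j))"
        by (rule eq_matI) (use sub in \<open>auto simp: metric_matrix_def\<close>)
      then show ?thesis using A sub \<rho> \<gamma> unfolding totally_unimodular_def by metis
    qed
  qed
  then show ?thesis unfolding totally_unimodular_def by blast
qed

lemma sum_lessThan_add: "(\<Sum>i<r + m. f i) = (\<Sum>i<r. f i) + (\<Sum>q<m. f (r + q :: nat))"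
  for f :: "nat \<Rightarrow> 'a :: comm_monoid_add"
  by (induction m) (auto simp: add_ac)

text \<open>Column \<open>g q\<close> is zero except in row \<open>r + q\<close>, so a relation
  between the rows has coefficient 0 there. What remains is a relation between the rows of
  \<open>A\<close>.\<close>

lemma full_row_rank_metric_matrix:
  assumes A: "full_row_rank A r E" and g: "bij_betw g {..<m} F"
    and disj: "E \<inter> F = {}" and p: "p ` F \<subseteq> E"
  shows "full_row_rank (metric_matrix A r E g p) (r + m) (E \<union> F)"
  unfolding full_row_rank_def
proof (intro allI impI)
  fix d :: "nat \<Rightarrow> rat" and i
  let ?N = "metric_matrix A r E g p"
  assume d: "\<forall>e\<in>E \<union> F. (\<Sum>i<r + m. d i * of_int (?N i e)) = 0" and i: "i < r + m"
  have gF: "g q \<in> F" if "q < m" for q using g that by (auto simp: bij_betw_def)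
  have gE: "g q \<notin> E" if "q < m" for q using gF[OF that] disj by blast
  have pg: "g q \<noteq> p (g q')" if "q < m" "q' < m" for q q' using gE that gF p by (metis image_subset_iff)
  have dm: "d (r + q) = 0" if q: "q < m" for q
  proof -
    have "(\<Sum>i<r. d i * of_int (?N i (g q))) = 0"
      using gF[OF q] disj by (intro sum.neutral) (auto simp: metric_matrix_def)
    moreover have "(\<Sum>q'<m. d (r + q') * of_int (?N (r + q') (g q))) =
      (\<Sum>q'<m. if q' = q then d (r + q) else 0)"
      using q pg pg[symmetric] g by (intro sum.cong) (auto simp: metric_matrix_def bij_betw_def inj_on_def)
    ultimately show ?thesis
      using d[rule_format, of "g q"] gF[OF q] q by (simp add: sum_lessThan_add)
  qed
  have "(\<Sum>i<r. d i * of_int (A i e)) = 0" if e: "e \<in> E" for e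
  proof -
    have "(\<Sum>i<r. d i * of_int (?N i e)) = (\<Sum>i<r. d i * of_int (A i e))"
      using e by (intro sum.cong) (auto simp: metric_matrix_def)
    then show ?thesis using d[rule_format, of e] e by (simp add: sum_lessThan_add dm)
  qed
  then have "d i = 0" if "i < r" for i using A that by (auto simp: full_row_rank_def)
  then show "d i = 0" using dm[of "i - r"] i by (cases "i < r") auto
qed

text \<open>A dependency of the columns in \<open>B\<close> is a kernel vector supported in
  \<open>B\<close>. It is constant on the fibres of \<open>p\<close>, hence zero on every fibre that
  leaves \<open>B\<close>; on the fibres inside \<open>B\<close> it is the same as a dependency of
  the columns of \<open>A\<close>.\<close>

lemma cols_indep_metric_matrix:
  fixes A :: "nat \<Rightarrow> 'e \<Rightarrow> int"
  assumes g: "bij_betw g {..<m} F" and disj: "E \<inter> F = {}" and fin: "finite E" "finite F"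
    and pF: "p ` F \<subseteq> E" and pE: "\<And>e. e \<in> E \<Longrightarrow> p e = e" and B: "B \<subseteq> E \<union> F"
  shows "cols_indep (metric_matrix A r E g p) (r + m) B \<longleftrightarrow>
    cols_indep A r {e \<in> E. \<forall>x\<in>E \<union> F. p x = e \<longrightarrow> x \<in> B}"
proof -
  let ?N = "metric_matrix A r E g p"
  let ?B' = "{e \<in> E. \<forall>x\<in>E \<union> F. p x = e \<longrightarrow> x \<in> B}"
  \<comment> \<open>A bottom row compares \<open>g q\<close> with \<open>p (g q)\<close>, and either
    may lie outside \<open>B\<close>; extension by zero lets all these equations be read
    alike.\<close>
  let ?ext = "\<lambda>c x. if x \<in> B then c x else (0::rat)"
  have finB: "finite B" using B fin finite_subset by blast
  have gF: "g q \<in> F" if "q < m" for q using g that by (auto simp: bij_betw_def)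
  have B'B: "?B' \<subseteq> B" using pE by auto
  have top: "(\<Sum>x\<in>B. c x * of_int (?N i x)) = (\<Sum>e\<in>E. ?ext c e * of_int (A i e))"
    if "i < r" for c i
  proof -
    have "(\<Sum>x\<in>B. c x * of_int (?N i x)) = (\<Sum>x\<in>B \<inter> E. c x * of_int (A i x))"
      using that finB by (intro sum.mono_neutral_cong_right) (auto simp: metric_matrix_def)
    also have "\<dots> = (\<Sum>e\<in>E. ?ext c e * of_int (A i e))"
      using fin by (intro sum.mono_neutral_cong_left) auto
    finally show ?thesis .
  qed
  have bot: "(\<Sum>x\<in>B. c x * of_int (?N (r + q) x)) = ?ext c (g q) - ?ext c (p (g q))"
    if q: "q < m" for c q
  proof -
    have ne: "g q \<noteq> p (g q)" using gF[OF q] pF disj by blast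
    have "(\<Sum>x\<in>B. c x * of_int (?N (r + q) x)) =
      (\<Sum>x\<in>B. (if x = g q then c x else 0) - (if x = p (g q) then c x else 0))"
      using ne by (intro sum.cong) (auto simp: metric_matrix_def)
    also have "\<dots> = ?ext c (g q) - ?ext c (p (g q))"
      using finB by (simp add: sum_subtractf sum.delta)
    finally show ?thesis .
  qed
  show ?thesis
  proof
    assume N: "cols_indep ?N (r + m) B"
    show "cols_indep A r ?B'" unfolding cols_indep_def
    proof (intro allI impI ballI)
      fix c :: "'e \<Rightarrow> rat" and e
      assume c: "\<forall>i<r. (\<Sum>e\<in>?B'. c e * of_int (A i e)) = 0" and e: "e \<in> ?B'"
      \<comment> \<open>The dependency of \<open>A\<close> is spread over the fibres: constant on
        those inside \<open>B\<close>, zero on the others.\<close>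
      define d where "d x = (if p x \<in> ?B' then c (p x) else 0)" for x
      have dB: "?ext d x = d x" if "x \<in> E \<union> F" for x
        using that by (auto simp: d_def)
      have "(\<Sum>x\<in>B. d x * of_int (?N i x)) = 0" if i: "i < r + m" for i
      proof (cases "i < r")
        case True
        have "(\<Sum>e\<in>E. ?ext d e * of_int (A i e)) = (\<Sum>e\<in>?B'. c e * of_int (A i e))"
          using fin dB pE B'B by (intro sum.mono_neutral_cong_right) (auto simp: d_def)
        then show ?thesis using c True by (simp add: top)
      next
        case False
        then obtain q where q: "i = r + q" "q < m" using i by (metis less_imp_add_positive add_less_cancel_left le_Suc_ex not_less)
        have "p (g q) \<in> E" using gF[OF q(2)] pF by blast
        then have "d (g q) = d (p (g q))" unfolding d_def by (simp only: pE)
        moreover have "?ext d (g q) = d (g q)" "?ext d (p (g q)) = d (p (g q))"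
          using dB gF[OF q(2)] \<open>p (g q) \<in> E\<close> by blast+
        ultimately show ?thesis unfolding q(1) bot[OF q(2)] by simp
      qed
      then have "\<forall>x\<in>B. d x = 0" using N by (simp add: cols_indep_def)
      then have "d e = 0" using e B'B by blast
      moreover have "p e = e" using e pE by blast
      ultimately show "c e = 0" using e unfolding d_def by simp
    qed
  next
    assume A: "cols_indep A r ?B'"
    show "cols_indep ?N (r + m) B" unfolding cols_indep_def
    proof (intro allI impI ballI)
      fix c :: "'e \<Rightarrow> rat" and x
      assume c: "\<forall>i<r + m. (\<Sum>x\<in>B. c x * of_int (?N i x)) = 0" and x: "x \<in> B"
      have const: "?ext c y = ?ext c (p y)" if "y \<in> E \<union> F" for y
      proof (cases "y \<in> F")
        case True
        then obtain q where q: "y = g q" "q < m" using g by (auto simp: bij_betw_def)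
        have "(\<Sum>x\<in>B. c x * of_int (?N (r + q) x)) = 0" using c q(2) by simp
        then show ?thesis unfolding bot[OF q(2), of c] q(1) by simp
      next
        case False
        then show ?thesis using that pE by simp
      qed
      have zero: "?ext c e = 0" if e: "e \<in> E" "e \<notin> ?B'" for e
      proof -
        obtain y where "y \<in> E \<union> F" "p y = e" "y \<notin> B" using e by blast
        then show ?thesis using const[of y] by (simp only: if_False)
      qed
      have "\<forall>i<r. (\<Sum>e\<in>?B'. ?ext c e * of_int (A i e)) = 0"
      proof (intro allI impI)
        fix i assume i: "i < r"
        have "(\<Sum>e\<in>?B'. ?ext c e * of_int (A i e)) = (\<Sum>e\<in>E. ?ext c e * of_int (A i e))"
          using fin zero by (intro sum.mono_neutral_cong_left) auto
        then show "(\<Sum>e\<in>?B'. ?ext c e * of_int (A i e)) = 0"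
          using c[rule_format, of i] i by (simp add: top)
      qed
      then have vanish: "\<forall>e\<in>?B'. ?ext c e = 0"
        using A[unfolded cols_indep_def, rule_format, of "?ext c"] by blast
      have "x \<in> E \<or> x \<in> F" using x B by blast
      then have px: "p x \<in> E" using pE pF by auto
      have "?ext c (p x) = 0"
      proof (cases "p x \<in> ?B'")
        case True
        show ?thesis by (rule bspec[OF vanish True])
      next
        case False
        show ?thesis by (rule zero[OF px False])
      qed
      moreover have "x \<in> E \<union> F" using x B by blast
      ultimately have "?ext c x = 0" using const by simp
      then show "c x = 0" using x by simp
    qed
  qed
qed

text \<open>For the extended matrix, a set of the right size is a basis exactly if the classes lying
  inside it are independent for \<open>A\<close>. Omitting one element from each class off a basis
  \<open>B\<close> leaves precisely the classes of \<open>B\<close>; the converse is a count of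
  omitted elements.\<close>

lemma regular_matroid_metric:
  assumes reg: "regular_matroid E Bs" and Ef: "\<And>e. e \<in> E \<Longrightarrow> finite (Ef e) \<and> e \<in> Ef e"
    and disj: "\<And>e f. e \<in> E \<Longrightarrow> f \<in> E \<Longrightarrow> e \<noteq> f \<Longrightarrow> Ef e \<inter> Ef f = {}"
  shows "regular_matroid (metric_ground E Ef) (metric_bases E Bs Ef)"
proof -
  obtain r A where E: "finite E" and A: "totally_unimodular A r E" "full_row_rank A r E"
    and rep: "represents A r E Bs"
    using reg by (auto simp: regular_matroid_def)
  define G where "G = metric_ground E Ef"
  define F where "F = G - E"
  have finG: "finite G" using E Ef by (auto simp: G_def metric_ground_def)
  have EF: "E \<inter> F = {}" "G = E \<union> F" using Ef by (auto simp: F_def G_def metric_ground_def)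
  then have finF: "finite F" using finG by simp
  define m where "m = card F"
  obtain g where g: "bij_betw g {..<m} F"
    using ex_bij_betw_nat_finite[OF finF] by (auto simp: m_def atLeast0LessThan)
  have "\<forall>x\<in>G. \<exists>e\<in>E. x \<in> Ef e" by (auto simp: G_def metric_ground_def)
  then obtain p where p: "\<And>x. x \<in> G \<Longrightarrow> p x \<in> E \<and> x \<in> Ef (p x)" by metis
  have pe: "p x = e \<longleftrightarrow> x \<in> Ef e" if "x \<in> G" "e \<in> E" for x e
    using p[OF that(1)] disj that(2) by blast
  have EG: "Ef e \<subseteq> G" if "e \<in> E" for e using that by (auto simp: G_def metric_ground_def)
  have pF: "p ` F \<subseteq> E" using p F_def by auto
  have pE: "p e = e" if "e \<in> E" for e using pe[of e e] Ef[OF that] EF that by blast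
  let ?N = "metric_matrix A r E g p"
  have indep: "cols_indep ?N (r + m) B \<longleftrightarrow> cols_indep A r {e \<in> E. Ef e \<subseteq> B}" if "B \<subseteq> G" for B
  proof -
    have "{e \<in> E. \<forall>x\<in>E \<union> F. p x = e \<longrightarrow> x \<in> B} = {e \<in> E. Ef e \<subseteq> B}"
      using pe EG unfolding EF(2)[symmetric] by blast
    then show ?thesis using cols_indep_metric_matrix[OF g EF(1) E finF pF pE, of B A r] that EF(2) by simp
  qed
  have cardG: "card G = card E + m" using EF E finF by (simp add: m_def card_Un_disjoint)
  have card_x: "card (x ` (E - B)) = card (E - B)" if "\<forall>e\<in>E - B. x e \<in> Ef e" for x B
    using that disj by (intro card_image inj_onI) (metis DiffD1 IntI empty_iff)
  have "represents ?N (r + m) G (metric_bases E Bs Ef)"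
    unfolding represents_def
  proof (intro subset_antisym subsetI)
    fix C assume "C \<in> metric_bases E Bs Ef"
    then obtain B x where C: "C = G - x ` (E - B)" and B: "B \<in> Bs" and x: "\<forall>e\<in>E - B. x e \<in> Ef e"
      by (auto simp: metric_bases_def G_def)
    have B': "B \<subseteq> E" "card B = r" "cols_indep A r B" using B rep by (auto simp: represents_def)
    have xG: "x ` (E - B) \<subseteq> G" using x EG by blast
    have "r \<le> card E" using B' E card_mono by blast
    then have "card C = r + m"
      using card_x[OF x] xG finG B' E cardG
      by (simp add: C card_Diff_subset finite_subset card_mono)
    moreover have "{e \<in> E. Ef e \<subseteq> C} = B"
    proof
      show "{e \<in> E. Ef e \<subseteq> C} \<subseteq> B" using x by (auto simp: C)
      show "B \<subseteq> {e \<in> E. Ef e \<subseteq> C}"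
      proof
        fix e assume e: "e \<in> B"
        then have "x f \<notin> Ef e" if "f \<in> E - B" for f
          using x that disj[of e f] B'(1) by blast
        then show "e \<in> {e \<in> E. Ef e \<subseteq> C}" using e B'(1) EG by (auto simp: C)
      qed
    qed
    ultimately show "C \<in> {B. B \<subseteq> G \<and> card B = r + m \<and> cols_indep ?N (r + m) B}"
      using indep[of C] B'(3) C by auto
  next
    fix C assume "C \<in> {B. B \<subseteq> G \<and> card B = r + m \<and> cols_indep ?N (r + m) B}"
    then have C: "C \<subseteq> G" "card C = r + m" "cols_indep ?N (r + m) C" by auto
    define B where "B = {e \<in> E. Ef e \<subseteq> C}"
    have B: "B \<subseteq> E" "cols_indep A r B" using indep[OF C(1)] C(3) by (auto simp: B_def)
    have cardB: "card B \<le> r" using card_le_if_cols_indep[OF _ B(2)] B(1) E finite_subset by blast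
    have "\<forall>e\<in>E - B. \<exists>y. y \<in> Ef e - C" by (auto simp: B_def)
    then obtain x where x: "\<forall>e\<in>E - B. x e \<in> Ef e - C" by metis
    then have sub: "x ` (E - B) \<subseteq> G - C" using EG by blast
    have cx: "card (x ` (E - B)) = card E - card B"
      using card_x[of B x] x B(1) E by (simp add: card_Diff_subset finite_subset)
    have cC: "card (G - C) = card E + m - (r + m)"
      using C finG cardG by (simp add: card_Diff_subset finite_subset)
    \<comment> \<open>\<open>C\<close> omits \<open>card E - r\<close> elements of \<open>G\<close>,
      and at least one from each of the \<open>card E - card B\<close> classes not inside it. Since
      \<open>card B \<le> r\<close>, the two counts agree: \<open>B\<close> has \<open>r\<close>
      elements and the chosen \<open>x e\<close> are all the omitted ones.\<close>
    have "r + m \<le> card E + m" using card_mono[OF finG C(1)] C(2) cardG by simp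
    moreover have "card B \<le> card E" using B(1) E card_mono by blast
    moreover have "card (x ` (E - B)) \<le> card (G - C)" using finG by (intro card_mono[OF _ sub]) simp
    ultimately have "card B = r" "card (G - C) \<le> card (x ` (E - B))"
      using cx cC cardB by linarith+
    moreover from this(2) have eq: "x ` (E - B) = G - C"
      using finG by (intro card_seteq[OF _ sub]) simp_all
    ultimately have "B \<in> Bs" using B rep by (auto simp: represents_def)
    moreover have "C = G - x ` (E - B)" using eq C(1) by blast
    ultimately show "C \<in> metric_bases E Bs Ef" using x by (auto simp: metric_bases_def G_def)
  qed
  then show ?thesis
    unfolding regular_matroid_def G_def[symmetric]
    using finG totally_unimodular_metric_matrix[OF A(1) g EF(1) pF]
      full_row_rank_metric_matrix[OF A(2) g EF(1) pF] EF(2) by metis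
qed

text \<open>The pair of a basis and a choice of omitted elements can be read off the resulting set:
  it contains the class of \<open>e\<close> if \<open>e\<close> is in \<open>B\<close>, and
  otherwise misses exactly \<open>x e\<close>. Extensional choice functions make the pair unique, so
  the bases are counted by a dependent sum.\<close>

lemma card_metric_bases:
  assumes E: "finite E" and Bs: "\<And>B. B \<in> Bs \<Longrightarrow> B \<subseteq> E" and Ef: "\<And>e. e \<in> E \<Longrightarrow> finite (Ef e)"
    and disj: "\<And>e f. e \<in> E \<Longrightarrow> f \<in> E \<Longrightarrow> e \<noteq> f \<Longrightarrow> Ef e \<inter> Ef f = {}"
  shows "card (metric_bases E Bs Ef) = (\<Sum>B\<in>Bs. \<Prod>e\<in>E - B. card (Ef e))"
proof -
  let ?S = "SIGMA B:Bs. PiE (E - B) Ef"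
  let ?h = "\<lambda>(B,x). metric_ground E Ef - x ` (E - B)"
  have finBs: "finite Bs" using Bs E by (meson Pow_iff finite_Pow_iff finite_subset subsetI)
  have finPi: "finite (PiE (E - B) Ef)" for B using E Ef by (intro finite_PiE) auto
  have img: "metric_bases E Bs Ef = ?h ` ?S"
  proof
    show "metric_bases E Bs Ef \<subseteq> ?h ` ?S"
    proof
      fix C assume "C \<in> metric_bases E Bs Ef"
      then obtain B x where C: "C = metric_ground E Ef - x ` (E - B)" "B \<in> Bs" "\<forall>e\<in>E - B. x e \<in> Ef e"
        by (auto simp: metric_bases_def)
      then have "C = ?h (B, restrict x (E - B))" "(B, restrict x (E - B)) \<in> ?S" by auto
      then show "C \<in> ?h ` ?S" by blast
    qed
    show "?h ` ?S \<subseteq> metric_bases E Bs Ef"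
    proof
      fix C assume "C \<in> ?h ` ?S"
      then obtain B x where "C = metric_ground E Ef - x ` (E - B)" "B \<in> Bs" "x \<in> PiE (E - B) Ef" by auto
      then show "C \<in> metric_bases E Bs Ef" unfolding metric_bases_def by (auto simp: PiE_iff)
    qed
  qed
  have trace: "Ef e - ?h (B,x) = (if e \<in> B then {} else {x e})"
    if "x \<in> PiE (E - B) Ef" "e \<in> E" for B x e
  proof -
    have *: "x e' \<in> Ef e'" if "e' \<in> E - B" for e' using that \<open>x \<in> PiE (E - B) Ef\<close> by auto
    have "Ef e - ?h (B,x) = Ef e \<inter> x ` (E - B)" using \<open>e \<in> E\<close> by (auto simp: metric_ground_def)
    also have "\<dots> = (if e \<in> B then {} else {x e})" using * disj[OF \<open>e \<in> E\<close>] \<open>e \<in> E\<close>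
      by (auto split: if_splits)
    finally show ?thesis .
  qed
  have "inj_on ?h ?S"
  proof (rule inj_onI)
    fix s t assume "s \<in> ?S" "t \<in> ?S" and eq: "?h s = ?h t"
    then obtain B x C y where s: "s = (B,x)" "B \<in> Bs" "x \<in> PiE (E - B) Ef"
      and t: "t = (C,y)" "C \<in> Bs" "y \<in> PiE (E - C) Ef" by blast
    have tr: "(if e \<in> B then {} else {x e}) = (if e \<in> C then {} else {y e})" if "e \<in> E" for e
      using trace[OF s(3) that] trace[OF t(3) that] eq s(1) t(1) by simp
    then have "B = C" using Bs[OF s(2)] Bs[OF t(2)] by (metis insert_not_empty subset_antisym subset_iff)
    moreover have "x = y"
    proof (rule PiE_ext[OF s(3)])
      show "y \<in> PiE (E - B) Ef" using t(3) \<open>B = C\<close> by simp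
      show "x e = y e" if "e \<in> E - B" for e using tr[of e] that \<open>B = C\<close> by simp
    qed
    ultimately show "s = t" using s t by simp
  qed
  then have "card (metric_bases E Bs Ef) = card ?S" unfolding img by (rule card_image)
  also have "\<dots> = (\<Sum>B\<in>Bs. \<Prod>e\<in>E - B. card (Ef e))"
    using finBs finPi E by (subst card_SigmaI) (auto simp: card_PiE)
  finally show ?thesis .
qed

section \<open>The order of the Jacobian group\<close>

text \<open>\<open>K\<close> is the adjugate scaled by \<open>u\<close>. Working over a commutative
  ring covers both later uses: the integral inverse of a unimodular minor and the rational inverse
  of the Gram matrix.\<close>

lemma matrix_inverse_entries:
  fixes f :: "nat \<Rightarrow> nat \<Rightarrow> 'a :: comm_ring_1"
  assumes u: "u * det (mat r r (\<lambda>(i,j). f i j)) = 1"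
  obtains K where "\<And>i k. i < r \<Longrightarrow> k < r \<Longrightarrow> (\<Sum>j<r. f i j * K j k) = (if i = k then 1 else 0)"
    "\<And>i k. i < r \<Longrightarrow> k < r \<Longrightarrow> (\<Sum>j<r. K i j * f j k) = (if i = k then 1 else 0)"
proof
  let ?M = "mat r r (\<lambda>(i,j). f i j)"
  let ?K = "\<lambda>i j. u * adj_mat ?M $$ (i,j)"
  note adj = adj_mat[of ?M r, simplified]
  fix i k assume ik: "i < r" "k < r"
  have "(\<Sum>j<r. f i j * adj_mat ?M $$ (j,k)) = (?M * adj_mat ?M) $$ (i,k)"
    using ik adj(1) by (auto simp: scalar_prod_def atLeast0LessThan intro!: sum.cong)
  then have "(\<Sum>j<r. f i j * adj_mat ?M $$ (j,k)) = (if i = k then det ?M else 0)"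
    using ik by (simp add: adj(2))
  then have "u * (\<Sum>j<r. f i j * adj_mat ?M $$ (j,k)) = (if i = k then 1 else 0)" using u by simp
  then show "(\<Sum>j<r. f i j * ?K j k) = (if i = k then 1 else 0)"
    by (simp add: sum_distrib_left mult.left_commute)
  have "(\<Sum>j<r. adj_mat ?M $$ (i,j) * f j k) = (adj_mat ?M * ?M) $$ (i,k)"
    using ik adj(1) by (auto simp: scalar_prod_def atLeast0LessThan intro!: sum.cong)
  then have "(\<Sum>j<r. adj_mat ?M $$ (i,j) * f j k) = (if i = k then det ?M else 0)"
    using ik by (simp add: adj(3))
  then have "u * (\<Sum>j<r. adj_mat ?M $$ (i,j) * f j k) = (if i = k then 1 else 0)" using u by simp
  then show "(\<Sum>j<r. ?K i j * f j k) = (if i = k then 1 else 0)"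
    by (simp add: sum_distrib_left mult.assoc)
qed

lemma inverse_apply:
  fixes P Q :: "nat \<Rightarrow> nat \<Rightarrow> 'a :: comm_ring_1"
  assumes "\<And>k. k < r \<Longrightarrow> (\<Sum>j<r. P i j * Q j k) = (if i = k then 1 else 0)" "i < r"
  shows "(\<Sum>j<r. P i j * (\<Sum>k<r. Q j k * z k)) = z i"
proof -
  have "(\<Sum>j<r. P i j * (\<Sum>k<r. Q j k * z k)) = (\<Sum>j<r. \<Sum>k<r. P i j * Q j k * z k)"
    by (simp add: sum_distrib_left mult.assoc)
  also have "\<dots> = (\<Sum>k<r. \<Sum>j<r. P i j * Q j k * z k)" by (rule sum.swap)
  also have "\<dots> = (\<Sum>k<r. (\<Sum>j<r. P i j * Q j k) * z k)" by (simp add: sum_distrib_right)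
  also have "\<dots> = (\<Sum>k<r. if i = k then z k else 0)" by (intro sum.cong) (auto simp: assms(1))
  finally show ?thesis using assms(2) by simp
qed

text \<open>Adjointness of a matrix and its transpose: it makes the row space orthogonal to the
  kernel.\<close>

lemma sum_mult_transpose:
  fixes y :: "'e \<Rightarrow> 'a :: comm_semiring_0"
  shows "(\<Sum>e\<in>G. (\<Sum>i\<in>I. v i * a i e) * y e) = (\<Sum>i\<in>I. v i * (\<Sum>e\<in>G. a i e * y e))"
proof -
  have "(\<Sum>e\<in>G. (\<Sum>i\<in>I. v i * a i e) * y e) = (\<Sum>e\<in>G. \<Sum>i\<in>I. v i * (a i e * y e))"
    by (simp add: sum_distrib_right mult.assoc)
  also have "\<dots> = (\<Sum>i\<in>I. \<Sum>e\<in>G. v i * (a i e * y e))" by (rule sum.swap)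
  finally show ?thesis by (simp add: sum_distrib_left)
qed

section \<open>The Gram matrix: its determinant and definiteness\<close>

definition gram :: "(nat \<Rightarrow> 'e \<Rightarrow> int) \<Rightarrow> nat \<Rightarrow> 'e set \<Rightarrow> int mat" where
  "gram A r G = mat r r (\<lambda>(i,j). \<Sum>e\<in>G. A i e * A j e)"

lemma det_gram_eq_card_bases:
  assumes G: "finite G" and A: "totally_unimodular A r G"
  shows "det (gram A r G) = int (card {B. B \<subseteq> G \<and> card B = r \<and> cols_indep A r B})"
proof -
  let ?Bs = "{B. B \<subseteq> G \<and> card B = r}"
  have "\<exists>b. bij_betw b {..<r} B" if "B \<subseteq> G" "card B = r" for B
    using ex_bij_betw_nat_finite[of B] that G finite_subset by (metis atLeast0LessThan)
  then obtain \<beta> where \<beta>: "\<And>B. B \<subseteq> G \<Longrightarrow> card B = r \<Longrightarrow> bij_betw (\<beta> B) {..<r} B" by metis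
  let ?d = "\<lambda>B. det (mat r r (\<lambda>(i,j). A i (\<beta> B j)))"
  have sq: "?d B * ?d B = (if cols_indep A r B then 1 else 0)" if B: "B \<subseteq> G" "card B = r" for B
  proof -
    have "?d B \<in> {-1,0,1}"
      using A[unfolded totally_unimodular_def, rule_format, of "\<lambda>i. i" r "\<beta> B"] \<beta>[OF B] B
      by (auto simp: bij_betw_def)
    then show ?thesis using cols_indep_iff_det[OF \<beta>[OF B], of A] by auto
  qed
  have "det (gram A r G) = (\<Sum>B\<in>?Bs. ?d B * ?d B)"
    unfolding gram_def by (rule cauchy_binet[OF G \<beta>])
  also have "\<dots> = (\<Sum>B\<in>?Bs. if cols_indep A r B then 1 else 0)"
    by (rule sum.cong) (use sq in auto)
  also have "\<dots> = int (card {B \<in> ?Bs. cols_indep A r B})"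
    using G by (simp add: sum.If_cases Int_def)
  finally show ?thesis by (simp add: conj_assoc)
qed

lemma sum_gram:
  fixes v :: "nat \<Rightarrow> 'a :: comm_ring_1"
  assumes "i < r"
  shows "(\<Sum>j<r. of_int (gram A r G $$ (i,j)) * v j) =
    (\<Sum>e\<in>G. of_int (A i e) * (\<Sum>j<r. v j * of_int (A j e)))"
proof -
  have "(\<Sum>j<r. of_int (gram A r G $$ (i,j)) * v j) =
    (\<Sum>j<r. \<Sum>e\<in>G. of_int (A i e) * (v j * of_int (A j e)))"
    using assms by (intro sum.cong) (auto simp: gram_def sum_distrib_right sum_distrib_left mult_ac)
  also have "\<dots> = (\<Sum>e\<in>G. of_int (A i e) * (\<Sum>j<r. v j * of_int (A j e)))"
    by (subst sum.swap) (simp add: sum_distrib_left)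
  finally show ?thesis .
qed

text \<open>Pairing \<open>A A\<^sup>T v = 0\<close> with \<open>v\<close> gives a vanishing sum of
  squares of the entries of \<open>A\<^sup>T v\<close>. So \<open>A\<^sup>T v = 0\<close>, and full
  row rank yields \<open>v = 0\<close>.\<close>

lemma gram_kernel:
  fixes v :: "nat \<Rightarrow> rat"
  assumes G: "finite G" and rank: "full_row_rank A r G"
    and v: "\<And>i. i < r \<Longrightarrow> (\<Sum>j<r. of_int (gram A r G $$ (i,j)) * v j) = 0" and "i < r"
  shows "v i = 0"
proof -
  let ?y = "\<lambda>e. \<Sum>j<r. v j * of_int (A j e)"
  have "0 = (\<Sum>i<r. v i * (\<Sum>e\<in>G. of_int (A i e) * ?y e))"
    using v by (simp add: sum_gram)
  also have "\<dots> = (\<Sum>e\<in>G. (\<Sum>i<r. v i * of_int (A i e)) * ?y e)"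
    by (rule sum_mult_transpose[symmetric])
  finally have "(\<Sum>e\<in>G. ?y e * ?y e) = 0" by simp
  then have "\<forall>e\<in>G. ?y e = 0" using G by (subst (asm) sum_nonneg_eq_0_iff) auto
  then show ?thesis using rank \<open>i < r\<close> unfolding full_row_rank_def by blast
qed

lemma det_gram_nonzero:
  assumes G: "finite G" and rank: "full_row_rank A r G"
  shows "det (gram A r G) \<noteq> 0"
proof
  assume "det (gram A r G) = 0"
  moreover have "map_mat rat_of_int (gram A r G) = mat r r (\<lambda>(i,j). of_int (gram A r G $$ (i,j)))"
    by (rule eq_matI) (auto simp: gram_def)
  ultimately have "det (mat r r (\<lambda>(i,j). rat_of_int (gram A r G $$ (i,j)))) = 0"
    by (metis of_int_hom.hom_det of_int_0)
  then obtain v j where "j < r" "v j \<noteq> 0"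
    "\<And>i. i < r \<Longrightarrow> (\<Sum>j<r. rat_of_int (gram A r G $$ (i,j)) * v j) = 0"
    unfolding det_0_iff_kernel by (auto simp: mult.commute)
  then show False using gram_kernel[OF G rank] by blast
qed

section \<open>Cosets of the lattice and integral splittings\<close>

lemma Lam_diff:
  assumes "x \<in> Lam A r G" "y \<in> Lam A r G"
  shows "(\<lambda>e. x e - y e) \<in> Lam A r G"
  using assms by (auto simp: Lam_def kerA_def right_diff_distrib sum_subtractf)

lemma Lam_coset_eq_iff:
  "(\<lambda>y e. x e + y e) ` Lam A r G = (\<lambda>y e. x' e + y e) ` Lam A r G \<longleftrightarrow> (\<lambda>e. x e - x' e) \<in> Lam A r G"
    (is "?C x = ?C x' \<longleftrightarrow> _")
proof
  have z: "(\<lambda>e. 0) \<in> Lam A r G" by (auto simp: Lam_def kerA_def)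
  assume "?C x = ?C x'"
  moreover have "x \<in> ?C x" using z by (rule rev_image_eqI) simp
  ultimately have "x \<in> ?C x'" by simp
  then show "(\<lambda>e. x e - x' e) \<in> Lam A r G" by auto
next
  have z: "(\<lambda>e. 0) \<in> Lam A r G" by (auto simp: Lam_def kerA_def)
  have sub: "?C x \<subseteq> ?C x'" if d: "(\<lambda>e. x' e - x e) \<in> Lam A r G" for x x' :: "'a \<Rightarrow> rat"
  proof
    fix u assume "u \<in> ?C x"
    then obtain y where "y \<in> Lam A r G" "u = (\<lambda>e. x e + y e)" by blast
    then show "u \<in> ?C x'" using Lam_diff[OF _ d]
      by (intro rev_image_eqI[of "\<lambda>e. y e - (x' e - x e)"]) auto
  qed
  assume d: "(\<lambda>e. x e - x' e) \<in> Lam A r G"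
  then show "?C x = ?C x'"
    using sub[of x x'] sub[of x' x] Lam_diff[OF z d] by auto
qed

text \<open>A basis with determinant \<open>\<plusminus>1\<close> splits \<open>A\<close> over the integers: \<open>A\<close> is onto, \<open>A\<^sup>T\<close> reflects
  integrality, and every functional that is integral on the lattice is induced by an integral vector.\<close>

lemma unimodular_basis:
  assumes G: "finite G" and A: "totally_unimodular A r G" and rank: "full_row_rank A r G"
  shows "\<exists>b K. inj_on b {..<r} \<and> b ` {..<r} \<subseteq> G \<and>
    (\<forall>i<r. \<forall>k<r. (\<Sum>j<r. A i (b j) * K j k) = (if i = k then 1 else 0)) \<and>
    (\<forall>i<r. \<forall>k<r. (\<Sum>j<r. K i j * A j (b k)) = (if i = k then 1 else 0))"
proof -
  have "card {B. B \<subseteq> G \<and> card B = r \<and> cols_indep A r B} \<noteq> 0"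
    using det_gram_nonzero[OF G rank] det_gram_eq_card_bases[OF G A] by simp
  then obtain B where B: "B \<subseteq> G" "card B = r" "cols_indep A r B"
    by (metis (mono_tags, lifting) card.empty empty_Collect_eq)
  obtain b where b: "bij_betw b {..<r} B"
    using ex_bij_betw_nat_finite[of B] B G finite_subset by (metis atLeast0LessThan)
  let ?d = "det (mat r r (\<lambda>(i,j). A i (b j)))"
  have "?d \<in> {-1,0,1}"
    using A[unfolded totally_unimodular_def, rule_format, of "\<lambda>i. i" r b] b B
    by (auto simp: bij_betw_def)
  then have "?d * ?d = 1" using cols_indep_iff_det[OF b, of A] B(3) by auto
  then obtain K where K: "\<And>i k. i < r \<Longrightarrow> k < r \<Longrightarrow> (\<Sum>j<r. A i (b j) * K j k) = (if i = k then 1 else 0)"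
    "\<And>i k. i < r \<Longrightarrow> k < r \<Longrightarrow> (\<Sum>j<r. K i j * A j (b k)) = (if i = k then 1 else 0)"
    using matrix_inverse_entries by blast
  show ?thesis
    by (intro exI[of _ b] exI[of _ K] conjI allI impI) (use b B(1) K in \<open>simp_all add: bij_betw_def\<close>)
qed

lemma totally_unimodular_surj:
  assumes G: "finite G" and A: "totally_unimodular A r G" and rank: "full_row_rank A r G"
  shows "\<exists>w :: 'e \<Rightarrow> int. \<forall>i<r. (\<Sum>e\<in>G. A i e * w e) = z i"
proof -
  obtain b K where b: "inj_on b {..<r}" "b ` {..<r} \<subseteq> G"
    and K: "\<forall>i<r. \<forall>k<r. (\<Sum>j<r. A i (b j) * K j k) = (if i = k then 1 else 0)"
    using unimodular_basis[OF G A rank] by blast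
  define w where "w e = (if e \<in> b ` {..<r} then \<Sum>k<r. K (inv_into {..<r} b e) k * z k else 0)" for e
  have wb: "w (b j) = (\<Sum>k<r. K j k * z k)" if "j < r" for j
    using that b by (simp add: w_def)
  have "(\<Sum>e\<in>G. A i e * w e) = z i" if "i < r" for i
  proof -
    have "(\<Sum>e\<in>G. A i e * w e) = (\<Sum>e\<in>b ` {..<r}. A i e * w e)"
      using G b by (intro sum.mono_neutral_right) (auto simp: w_def)
    also have "\<dots> = (\<Sum>j<r. A i (b j) * (\<Sum>k<r. K j k * z k))"
      using b by (simp add: sum.reindex wb)
    also have "\<dots> = z i" using that K by (intro inverse_apply) auto
    finally show ?thesis .
  qed
  then show ?thesis by blast
qed

lemma totally_unimodular_reflects_Ints:
  fixes v :: "nat \<Rightarrow> rat"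
  assumes G: "finite G" and A: "totally_unimodular A r G" and rank: "full_row_rank A r G"
    and v: "\<And>e. e \<in> G \<Longrightarrow> (\<Sum>i<r. v i * of_int (A i e)) \<in> \<int>" and "i < r"
  shows "v i \<in> \<int>"
proof -
  obtain b K where b: "inj_on b {..<r}" "b ` {..<r} \<subseteq> G"
    and K: "\<forall>i<r. \<forall>k<r. (\<Sum>j<r. A i (b j) * K j k) = (if i = k then 1 else 0)"
    using unimodular_basis[OF G A rank] by blast
  \<comment> \<open>The inverse identity is used in transposed form: \<open>v\<close> is recovered
    with integer coefficients from the entries of \<open>A\<^sup>T v\<close> at the basis
    elements.\<close>
  have "v i = (\<Sum>j<r. of_int (K j i) * (\<Sum>k<r. of_int (A k (b j)) * v k))"
    using \<open>i < r\<close>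
    by (intro inverse_apply[where P = "\<lambda>i j. of_int (K j i)" and Q = "\<lambda>j k. of_int (A k (b j))", symmetric])
      (use K in \<open>auto simp: mult.commute simp flip: of_int_mult of_int_sum\<close>)
  also have "\<dots> \<in> \<int>"
  proof (rule Ints_sum, rule Ints_mult[OF Ints_of_int])
    fix j assume "j \<in> {..<r}"
    then have "b j \<in> G" using b by auto
    from v[OF this] show "(\<Sum>k<r. of_int (A k (b j)) * v k) \<in> \<int>" by (simp add: mult.commute)
  qed
  finally show ?thesis .
qed

text \<open>Adding a row-space vector leaves all pairings with the lattice unchanged. With
  \<open>d\<close> chosen so that the sum vanishes on a unimodular basis, each remaining coordinate
  equals the pairing of \<open>x\<close> with a single lattice vector, hence is an integer.\<close>

lemma Lam_dual_integral_representative: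
  assumes G: "finite G" and A: "totally_unimodular A r G" and rank: "full_row_rank A r G"
    and x: "x \<in> Lam_dual A r G"
  shows "\<exists>(w :: 'e \<Rightarrow> int) d. \<forall>e\<in>G. of_int (w e) = x e + (\<Sum>i<r. d i * of_int (A i e))"
proof -
  obtain b K where b: "inj_on b {..<r}" "b ` {..<r} \<subseteq> G"
    and K1: "\<forall>i<r. \<forall>k<r. (\<Sum>j<r. A i (b j) * K j k) = (if i = k then 1 else 0)"
    and K2: "\<forall>i<r. \<forall>k<r. (\<Sum>j<r. K i j * A j (b k)) = (if i = k then 1 else 0)"
    using unimodular_basis[OF G A rank] by blast
  let ?B = "b ` {..<r}"
  define d where "d i = (\<Sum>k<r. of_int (K k i) * - x (b k))" for i
  define W where "W e = x e + (\<Sum>i<r. d i * of_int (A i e))" for e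
  have WB: "W e = 0" if e: "e \<in> ?B" for e
  proof -
    obtain k where k: "e = b k" "k < r" using e by auto
    have "(\<Sum>i<r. of_int (A i (b k)) * d i) = - x (b k)"
      unfolding d_def using k
      by (intro inverse_apply[where P = "\<lambda>k i. of_int (A i (b k))" and Q = "\<lambda>j k. of_int (K k j)"])
        (use K2 in \<open>auto simp: mult.commute simp flip: of_int_mult of_int_sum\<close>)
    then show ?thesis by (simp add: W_def k mult.commute)
  qed
  have "W e \<in> \<int>" if e: "e \<in> G" for e
  proof (cases "e \<in> ?B")
    case True
    then show ?thesis by (simp add: WB)
  next
    case False
    \<comment> \<open>The fundamental circuit vector of \<open>e\<close>: it is 1 at
      \<open>e\<close>, 0 at the other elements off the basis, and on the basis it holds the
      coefficients that cancel column \<open>e\<close>. They are integers because \<open>K\<close>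
      is.\<close>
    define y :: "'e \<Rightarrow> rat" where "y f = (if f = e then 1 else if f \<in> ?B
      then \<Sum>k<r. of_int (K (inv_into {..<r} b f) k) * - of_int (A k e) else 0)" for f
    have yb: "y (b j) = (\<Sum>k<r. of_int (K j k) * - of_int (A k e))" if "j < r" for j
      using that b False by (auto simp: y_def)
    have sums: "(\<Sum>f\<in>G. h f * y f) = h e + (\<Sum>j<r. h (b j) * y (b j))" for h :: "'e \<Rightarrow> rat"
    proof -
      have "(\<Sum>f\<in>G. h f * y f) = (\<Sum>f\<in>insert e ?B. h f * y f)"
        using G b e by (intro sum.mono_neutral_right) (auto simp: y_def)
      also have "\<dots> = h e * y e + (\<Sum>f\<in>?B. h f * y f)" using False by simp
      also have "(\<Sum>f\<in>?B. h f * y f) = (\<Sum>j<r. h (b j) * y (b j))" using b by (simp add: sum.reindex)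
      finally show ?thesis by (simp add: y_def)
    qed
    have ker: "(\<Sum>f\<in>G. of_int (A i f) * y f) = 0" if "i < r" for i
    proof -
      have "(\<Sum>j<r. of_int (A i (b j)) * y (b j)) =
        (\<Sum>j<r. of_int (A i (b j)) * (\<Sum>k<r. of_int (K j k) * - rat_of_int (A k e)))"
        by (intro sum.cong) (auto simp: yb)
      also have "\<dots> = - of_int (A i e)"
        using that
        by (intro inverse_apply) (use K1 in \<open>auto simp flip: of_int_mult of_int_sum\<close>)
      finally show ?thesis by (simp add: sums)
    qed
    have "y f \<in> \<int>" for f by (auto simp: y_def)
    then have "y \<in> Lam A r G" using ker b e by (auto simp: Lam_def kerA_def y_def)
    then have "(\<Sum>f\<in>G. x f * y f) \<in> \<int>" using x by (auto simp: Lam_dual_def)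
    also have "(\<Sum>f\<in>G. x f * y f) = (\<Sum>f\<in>G. W f * y f) - (\<Sum>f\<in>G. (\<Sum>i<r. d i * of_int (A i f)) * y f)"
      by (simp add: W_def algebra_simps sum.distrib)
    also have "(\<Sum>f\<in>G. (\<Sum>i<r. d i * of_int (A i f)) * y f) =
      (\<Sum>i<r. d i * (\<Sum>f\<in>G. of_int (A i f) * y f))"
      by (rule sum_mult_transpose)
    also have "\<dots> = 0" using ker by simp
    also have "(\<Sum>f\<in>G. W f * y f) = W e" using WB by (simp add: sums)
    finally show ?thesis by simp
  qed
  then have "\<forall>e\<in>G. of_int \<lfloor>W e\<rfloor> = W e" by simp
  then show ?thesis
    unfolding W_def by (intro exI[of _ "\<lambda>e. \<lfloor>x e + (\<Sum>i<r. d i * of_int (A i e))\<rfloor>"] exI[of _ d])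
qed

text \<open>The representatives in \<open>T\<close> are mapped to dual vectors \<open>X t\<close>,
  and these are shown to meet every coset of \<open>\<Lambda>\<close> exactly once. Surjectivity
  uses integral representatives of dual vectors, injectivity that \<open>A\<^sup>T\<close> reflects
  integrality.\<close>

lemma card_jac:
  assumes G: "finite G" and A: "totally_unimodular A r G" and rank: "full_row_rank A r G"
  shows "int (card (jac A r G)) = \<bar>det (gram A r G)\<bar>"
proof -
  let ?M = "gram A r G" and ?a = "\<lambda>i e. rat_of_int (A i e)"
  let ?m = "\<lambda>i j. rat_of_int (?M $$ (i,j))"
  have M: "?M \<in> carrier_mat r r" by (simp add: gram_def)
  obtain T where T: "transversal r (col_lattice ?M) T" "int (card T) = \<bar>det ?M\<bar>"
    using transversal_exists[OF M det_gram_nonzero[OF G rank]] by blast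
  then have Tc: "T \<subseteq> carrier_vec r" by (simp add: transversal_def)
  have lattice: "z \<in> col_lattice ?M \<longleftrightarrow>
      (\<exists>v :: nat \<Rightarrow> int. \<forall>i<r. rat_of_int (z $ i) = (\<Sum>j<r. ?m i j * of_int (v j)))"
    if z: "z \<in> carrier_vec r" for z
  proof -
    have Mv: "(?M *\<^sub>v v) $ i = (\<Sum>j<r. ?M $$ (i,j) * v $ j)" if "v \<in> carrier_vec r" "i < r" for v i
      using that M by (auto simp: scalar_prod_def atLeast0LessThan intro!: sum.cong)
    have "z \<in> col_lattice ?M \<longleftrightarrow> (\<exists>v\<in>carrier_vec r. \<forall>i<r. z $ i = (\<Sum>j<r. ?M $$ (i,j) * v $ j))"
    proof -
      have "z = ?M *\<^sub>v v \<longleftrightarrow> (\<forall>i<r. z $ i = (\<Sum>j<r. ?M $$ (i,j) * v $ j))" if "v \<in> carrier_vec r" for v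
        using M z Mv[OF that] by (metis carrier_matD(1) carrier_vecD dim_mult_mat_vec eq_vecI)
      then show ?thesis using M unfolding col_lattice_def by (auto simp del: index_mult_mat_vec)
    qed
    also have "\<dots> \<longleftrightarrow> (\<exists>v :: nat \<Rightarrow> int. \<forall>i<r. z $ i = (\<Sum>j<r. ?M $$ (i,j) * v j))"
    proof
      assume "\<exists>v :: nat \<Rightarrow> int. \<forall>i<r. z $ i = (\<Sum>j<r. ?M $$ (i,j) * v j)"
      then obtain v :: "nat \<Rightarrow> int" where "\<forall>i<r. z $ i = (\<Sum>j<r. ?M $$ (i,j) * v j)" by blast
      then show "\<exists>v\<in>carrier_vec r. \<forall>i<r. z $ i = (\<Sum>j<r. ?M $$ (i,j) * v $ j)"
        by (intro bexI[of _ "vec r v"]) auto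
    qed blast
    also have "\<dots> \<longleftrightarrow> (\<exists>v :: nat \<Rightarrow> int. \<forall>i<r. rat_of_int (z $ i) = (\<Sum>j<r. ?m i j * of_int (v j)))"
      by (simp flip: of_int_mult of_int_sum)
    finally show ?thesis .
  qed
  have "map_mat rat_of_int ?M = mat r r (\<lambda>(i,j). ?m i j)"
    by (rule eq_matI) (auto simp: gram_def)
  then have "det (mat r r (\<lambda>(i,j). ?m i j)) \<noteq> 0"
    using det_gram_nonzero[OF G rank] by (metis of_int_hom.hom_det of_int_eq_0_iff)
  then have "inverse (det (mat r r (\<lambda>(i,j). ?m i j))) * det (mat r r (\<lambda>(i,j). ?m i j)) = 1" by simp
  then obtain K where K: "\<And>i k. i < r \<Longrightarrow> k < r \<Longrightarrow> (\<Sum>j<r. ?m i j * K j k) = (if i = k then 1 else 0)"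
    and "\<And>i k. i < r \<Longrightarrow> k < r \<Longrightarrow> (\<Sum>j<r. K i j * ?m j k) = (if i = k then 1 else 0)"
    using matrix_inverse_entries by blast
  \<comment> \<open>The rational solution of the Gram system with right-hand side
    \<open>t\<close>.\<close>
  define d where "d t j = (\<Sum>k<r. K j k * rat_of_int (t $ k))" for t j
  have d: "(\<Sum>j<r. ?m i j * d t j) = of_int (t $ i)" if "i < r" for t i
    unfolding d_def using K that by (intro inverse_apply) auto
  have "\<forall>t. \<exists>w :: 'a \<Rightarrow> int. \<forall>i<r. (\<Sum>e\<in>G. A i e * w e) = t $ i"
    using totally_unimodular_surj[OF G A rank] by blast
  then obtain w :: "int vec \<Rightarrow> 'a \<Rightarrow> int" where w0: "\<And>t i. i < r \<Longrightarrow> (\<Sum>e\<in>G. A i e * w t e) = t $ i"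
    by metis
  have w: "(\<Sum>e\<in>G. ?a i e * of_int (w t e)) = of_int (t $ i)" if "i < r" for i t
    unfolding w0[OF that, of t, symmetric] by simp
  define At where "At v e = (\<Sum>j<r. v j * ?a j e)" for v e
  have AAt: "(\<Sum>e\<in>G. ?a i e * At v e) = (\<Sum>j<r. ?m i j * v j)" if "i < r" for i v
    unfolding At_def by (rule sum_gram[OF that, symmetric])
  have AAtd: "(\<Sum>e\<in>G. ?a i e * At (d t) e) = of_int (t $ i)" if "i < r" for i t
    using AAt[OF that] d[OF that] by simp
  have At_diff: "At (\<lambda>j. u j - v j) e = At u e - At v e" for u v e
    by (simp add: At_def algebra_simps sum_subtractf)
  \<comment> \<open>The orthogonal projection of \<open>w t\<close> onto the kernel, set to 0
    outside \<open>G\<close> as \<open>kerA\<close> demands. Another integral preimage of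
    \<open>t\<close> would change it by a lattice vector.\<close>
  define X where "X t e = (if e \<in> G then of_int (w t e) - At (d t) e else 0)" for t e
  have AX: "(\<Sum>e\<in>G. ?a i e * X t e) = 0" if "i < r" for i t
    using w[OF that] AAtd[OF that] by (simp add: X_def right_diff_distrib sum_subtractf)
  have X_dual: "X t \<in> Lam_dual A r G" for t
  proof -
    have "(\<Sum>e\<in>G. X t e * y e) \<in> \<int>" if y: "y \<in> Lam A r G" for y
    proof -
      have "(\<Sum>e\<in>G. At (d t) e * y e) = (\<Sum>j<r. d t j * (\<Sum>e\<in>G. ?a j e * y e))"
        unfolding At_def by (rule sum_mult_transpose)
      also have "\<dots> = 0" using y by (simp add: Lam_def kerA_def)
      finally have "(\<Sum>e\<in>G. X t e * y e) = (\<Sum>e\<in>G. of_int (w t e) * y e)"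
        by (simp add: X_def left_diff_distrib sum_subtractf)
      also have "\<dots> \<in> \<int>" using y by (intro Ints_sum Ints_mult) (auto simp: Lam_def)
      finally show ?thesis .
    qed
    then show ?thesis using AX by (auto simp: Lam_dual_def kerA_def X_def)
  qed
  have onto: "\<exists>t\<in>T. (\<lambda>e. x e - X t e) \<in> Lam A r G" if x: "x \<in> Lam_dual A r G" for x
  proof -
    obtain u c where u: "\<And>e. e \<in> G \<Longrightarrow> rat_of_int (u e) = x e + At c e"
      using Lam_dual_integral_representative[OF G A rank x] unfolding At_def by blast
    define z where "z = vec r (\<lambda>i. \<Sum>e\<in>G. A i e * u e)"
    have kx: "(\<Sum>e\<in>G. ?a i e * x e) = 0" if "i < r" for i using x that by (auto simp: Lam_dual_def kerA_def)
    have "z \<in> carrier_vec r" by (simp add: z_def)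
    then obtain t where t: "t \<in> T" "z - t \<in> col_lattice ?M" using T by (auto simp: transversal_def)
    have tc: "t \<in> carrier_vec r" using t Tc by auto
    have "z - t \<in> carrier_vec r" using tc \<open>z \<in> carrier_vec r\<close> by simp
    then obtain v :: "nat \<Rightarrow> int" where v: "\<And>i. i < r \<Longrightarrow> rat_of_int ((z - t) $ i) = (\<Sum>j<r. ?m i j * of_int (v j))"
      using t(2) lattice by blast
    \<comment> \<open>Both \<open>c\<close> and \<open>d t + v\<close> solve the Gram system with
      right-hand side \<open>z\<close>: the first because \<open>A x = 0\<close> and
      \<open>A u = z\<close>, the second because \<open>z = t + (z - t)\<close>. They therefore
      agree, and \<open>x - X t\<close> becomes \<open>u - w t - A\<^sup>T v\<close>, which is
      integral.\<close>
    have "c i - (d t i + of_int (v i)) = 0" if i: "i < r" for i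
    proof (rule gram_kernel[OF G rank _ i])
      fix i assume i: "i < r"
      have "(\<Sum>j<r. ?m i j * c j) = (\<Sum>e\<in>G. ?a i e * of_int (u e))"
        using kx[OF i] u by (simp add: AAt[OF i, symmetric] ring_distribs sum.distrib)
      also have "\<dots> = of_int (z $ i)" using i by (simp add: z_def)
      also have "\<dots> = of_int (t $ i) + of_int ((z - t) $ i)" using i tc by (simp add: z_def)
      finally show "(\<Sum>j<r. ?m i j * (c j - (d t j + of_int (v j)))) = 0"
        using d[OF i, of t] v[OF i] by (simp add: ring_distribs sum_subtractf sum.distrib)
    qed
    then have Atc: "At c e = At (d t) e + At (\<lambda>j. of_int (v j)) e" for e
      unfolding At_def sum.distrib[symmetric] by (intro sum.cong) (auto simp: algebra_simps)
    have Atv: "At (\<lambda>j. of_int (v j)) e \<in> \<int>" for e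
      unfolding At_def by (intro Ints_sum Ints_mult) auto
    have int: "x e - X t e \<in> \<int>" for e
    proof (cases "e \<in> G")
      case True
      have "x e - X t e = of_int (u e) - of_int (w t e) - At (\<lambda>j. of_int (v j)) e"
        using True u[OF True] Atc by (simp add: X_def)
      then show ?thesis using Atv by simp
    next
      case False
      then show ?thesis using x by (simp add: X_def Lam_dual_def kerA_def)
    qed
    have "(\<lambda>e. x e - X t e) \<in> Lam A r G"
      using int kx AX x
      by (auto simp: Lam_def kerA_def Lam_dual_def X_def right_diff_distrib sum_subtractf)
    then show ?thesis using t(1) by blast
  qed
  have inj: "t = s" if ts: "t \<in> T" "s \<in> T" and L: "(\<lambda>e. X t e - X s e) \<in> Lam A r G" for t s
  proof -
    let ?v = "\<lambda>j. d t j - d s j"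
    have c: "t \<in> carrier_vec r" "s \<in> carrier_vec r" using ts Tc by auto
    \<comment> \<open>Integrality of \<open>X t - X s\<close> passes to
      \<open>A\<^sup>T (d t - d s)\<close> because \<open>w t\<close> and \<open>w s\<close> are
      integral, and from there to \<open>d t - d s\<close>. Hence
      \<open>t - s = A A\<^sup>T (d t - d s)\<close> lies in the column lattice.\<close>
    have "At ?v e \<in> \<int>" if e: "e \<in> G" for e
    proof -
      have "X t e - X s e \<in> \<int>" using L by (auto simp: Lam_def)
      then have "of_int (w t e) - of_int (w s e) - (X t e - X s e) \<in> \<int>" by simp
      moreover have "of_int (w t e) - of_int (w s e) - (X t e - X s e) = At ?v e"
        using e by (simp add: X_def At_diff)
      ultimately show ?thesis by simp
    qed
    then have "?v j \<in> \<int>" if "j < r" for j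
      using totally_unimodular_reflects_Ints[OF G A rank, of ?v] that unfolding At_def by blast
    then have fl: "of_int \<lfloor>?v j\<rfloor> = ?v j" if "j < r" for j using that by simp
    have "rat_of_int ((t - s) $ i) = (\<Sum>j<r. ?m i j * of_int \<lfloor>?v j\<rfloor>)" if i: "i < r" for i
    proof -
      have "(\<Sum>j<r. ?m i j * of_int \<lfloor>?v j\<rfloor>) = (\<Sum>j<r. ?m i j * ?v j)"
        by (intro sum.cong) (auto simp: fl simp del: of_int_floor)
      also have "\<dots> = of_int (t $ i) - of_int (s $ i)"
        using d[OF i] by (simp add: right_diff_distrib sum_subtractf)
      finally show ?thesis using i c by simp
    qed
    then have "t - s \<in> col_lattice ?M" using lattice[of "t - s"] c by (metis minus_carrier_vec)
    moreover have "t - t \<in> col_lattice ?M"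
      using lattice[of "t - t"] c by (auto intro!: exI[of _ "\<lambda>_. 0"])
    ultimately show "t = s" using T(1) ts c unfolding transversal_def by blast
  qed
  let ?C = "\<lambda>x. (\<lambda>y e. x e + y e) ` Lam A r G"
  have "jac A r G = (\<lambda>t. ?C (X t)) ` T"
  proof
    show "jac A r G \<subseteq> (\<lambda>t. ?C (X t)) ` T"
    proof
      fix Y assume "Y \<in> jac A r G"
      then obtain x where x: "x \<in> Lam_dual A r G" "Y = ?C x" unfolding jac_def by blast
      from onto[OF x(1)] obtain t where t: "t \<in> T" "(\<lambda>e. x e - X t e) \<in> Lam A r G" by blast
      then have "Y = ?C (X t)" unfolding x(2) Lam_coset_eq_iff by simp
      then show "Y \<in> (\<lambda>t. ?C (X t)) ` T" using t(1) by (rule image_eqI)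
    qed
    show "(\<lambda>t. ?C (X t)) ` T \<subseteq> jac A r G" using X_dual by (auto simp: jac_def)
  qed
  moreover have "inj_on (\<lambda>t. ?C (X t)) T"
    by (rule inj_onI) (simp only: Lam_coset_eq_iff inj)
  ultimately show ?thesis using T(2) by (simp add: card_image)
qed

theorem theorem4p7:
  fixes E :: "'e set" and Bs :: "'e set set" and lam :: "'e \<Rightarrow> nat" and Ef :: "'e \<Rightarrow> 'e set"
  assumes "regular_matroid E Bs"
    and "\<forall>e\<in>E. lam e \<ge> 1"
    and "\<forall>e\<in>E. finite (Ef e) \<and> card (Ef e) = lam e \<and> e \<in> Ef e"
    and "\<forall>e\<in>E. \<forall>f\<in>E. e \<noteq> f \<longrightarrow> Ef e \<inter> Ef f = {}"
  shows "regular_matroid (metric_ground E Ef) (metric_bases E Bs Ef) \<and>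
    (\<forall>r A. totally_unimodular A r (metric_ground E Ef) \<and> full_row_rank A r (metric_ground E Ef)
        \<and> represents A r (metric_ground E Ef) (metric_bases E Bs Ef)
      \<longrightarrow> card (jac A r (metric_ground E Ef)) = config_poly_eval E Bs lam)"
proof (intro conjI allI impI)
  have E: "finite E" and Bs: "\<And>B. B \<in> Bs \<Longrightarrow> B \<subseteq> E"
    using assms(1) by (auto simp: regular_matroid_def represents_def)
  show "regular_matroid (metric_ground E Ef) (metric_bases E Bs Ef)"
    using assms(3,4) by (intro regular_matroid_metric[OF assms(1)]) auto
  fix r A
  let ?G = "metric_ground E Ef"
  assume A: "totally_unimodular A r ?G \<and> full_row_rank A r ?G \<and>
    represents A r ?G (metric_bases E Bs Ef)"
  have G: "finite ?G" using E assms(3) by (auto simp: metric_ground_def)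
  have "int (card (jac A r ?G)) = \<bar>det (gram A r ?G)\<bar>" using card_jac[OF G] A by blast
  also have "\<dots> = int (card (metric_bases E Bs Ef))"
    using det_gram_eq_card_bases[OF G, of A r] A by (simp add: represents_def)
  also have "card (metric_bases E Bs Ef) = (\<Sum>B\<in>Bs. \<Prod>e\<in>E - B. card (Ef e))"
    using assms(3,4) E Bs by (intro card_metric_bases) auto
  also have "\<dots> = config_poly_eval E Bs lam"
    using assms(3) by (simp add: config_poly_eval_def)
  finally show "card (jac A r ?G) = config_poly_eval E Bs lam" by simp
qed

end
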